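(* Let $A$ be an algebra over a field $k$, with product $\mu$ and unit map $\iota: k\to A$, and let $C$ be a coalgebra over $k$, with coproduct $\Delta$ and counit $\epsilon$. For any $s,r,t,p\in k$ define linear maps $$W: A\otimes A\to A\otimes A,\qquad a\otimes b\mapsto s\, ba\otimes 1 + r\, 1\otimes ba - s\, b\otimes a,$$ $$Z: C\otimes C\to C\otimes C,\qquad c\otimes d\mapsto t\,\epsilon(c)\sum d_{(1)}\otimes d_{(2)} + p\,\epsilon(d)\sum c_{(1)}\otimes c_{(2)} - p\, d\otimes c.$$ Let $X: A\otimes C\to A\otimes C$ be a linear map such that $X\circ(\iota\otimes I_C)=\iota\otimes I_C$ and $(I_A\otimes\epsilon)\circ X = I_A\otimes\epsilon$. Then $W,X,Z$ is a Yang-Baxter system if and only if $A$ is entwined with $C$ by the map $\psi := X\circ\tau_{C,A}: C\otimes A\to A\otimes C$.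
   Context: Throughout, $k$ is a field, $\otimes=\otimes_k$, all algebras are associative unital $k$-algebras and all coalgebras are coassociative counital $k$-coalgebras. $I_V$ denotes the identity map on a vector space $V$. For $c\in C$, Sweedler's notation is $\Delta(c)=\sum c_{(1)}\otimes c_{(2)}$. For vector spaces $V,V'$, $\tau_{V,V'}: V\otimes V'\to V'\otimes V$ is the flip $v\otimes v'\mapsto v'\otimes v$. The equality $X\circ(\iota\otimes I_C)=\iota\otimes I_C$ means $X(1\otimes c)=1\otimes c$ for all $c\in C$ (identifying $k\otimes C=C$), and $(I_A\otimes\epsilon)\circ X=I_A\otimes\epsilon$ is an equality of maps $A\otimes C\to A\otimes k=A$. Yang-Baxter commutator: for vector spaces $V,V',V''$ and linear maps $R:V\otimes V'\to V\otimes V'$, $S:V\otimes V''\to V\otimes V''$, $T:V'\otimes V''\to V'\otimes V''$, define the linear endomorphism of $V\otimes V'\otimes V''$ $$[R,S,T]=R_{12}\circ S_{13}\circ T_{23}-T_{23}\circ S_{13}\circ R_{12},$$ where $R_{12}=R\otimes I_{V''}$, $T_{23}=I_V\otimes T$, and $S_{13}$ is $S$ acting on the first and third tensor factors and as the identity on the second factor. Yang-Baxter system (WXZ-system): for vector spaces $V,V'$, a system of linear maps $W:V\otimes V\to V\otimes V$, $Z:V'\otimes V'\to V'\otimes V'$, $X:V\otimes V'\to V\otimes V'$ is a Yang-Baxter system if $[W,W,W]=0$, $[Z,Z,Z]=0$, $[W,X,X]=0$ and $[X,X,Z]=0$. (No invertibility is required.) In the claim, $V=A$ and $V'=C$. Entwining: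 $A$ is entwined with $C$ by a linear map $\psi:C\otimes A\to A\otimes C$ if (1) $\psi\circ(I_C\otimes\mu)=(\mu\otimes I_C)\circ(I_A\otimes\psi)\circ(\psi\otimes I_A)$; (2) $(I_A\otimes\Delta)\circ\psi=(\psi\otimes I_C)\circ(I_C\otimes\psi)\circ(\Delta\otimes I_A)$; (3) $\psi\circ(I_C\otimes\iota)=\iota\otimes I_C$, i.e. $\psi(c\otimes 1)=1\otimes c$ for all $c\in C$; (4) $(I_A\otimes\epsilon)\circ\psi=\epsilon\otimes I_A$, i.e. $(I_A\otimes\epsilon)(\psi(c\otimes a))=\epsilon(c)a$ for all $a\in A$, $c\in C$.
   Formalization: For fixed s,r,t,p, "Yang-Baxter system implies entwined" is proved only if s+r≠0 and t+p≠0; it is false otherwise (e.g. s=r=t=p=0). The other implication holds for all s,r,t,p, and the equivalence also holds with "Yang-Baxter system for all s,r,t,p". *)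

theory Defs
  imports "HOL.Vector_Spaces" "HOL-Library.Function_Algebras"
begin

section \<open>Tensor products over a field\<close>

text \<open>
  Vector spaces over a field \<open>'k\<close> are given, as in \<^theory>\<open>HOL.Vector_Spaces\<close>, by a type together
  with its scalar multiplication.  \<open>V \<otimes> W\<close> is realised inside the linear dual of the space of
  bilinear forms on \<open>V \<times> W\<close>: the pure tensor \<open>v \<otimes> w\<close> is evaluation at \<open>(v, w)\<close>, and \<open>V \<otimes> W\<close>
  is the linear span of the pure tensors.  Over a field this has the universal property of the
  tensor product (\<open>lift2_exists\<close>, \<open>lift2_unique\<close> below; \<open>lift3_exists\<close>, \<open>lift3_unique\<close> for
  threefold tensor products).  Functionals are set to \<open>0\<close> on functions that are not bilinear
  forms, so that equality in \<open>V \<otimes> W\<close> is plain equality.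
\<close>

definition fscale :: "'k::field \<Rightarrow> ('x \<Rightarrow> 'k) \<Rightarrow> 'x \<Rightarrow> 'k" where
  "fscale c \<phi> = (\<lambda>x. c * \<phi> x)"

definition bilinear_map ::
  "('k::field \<Rightarrow> 'v::ab_group_add \<Rightarrow> 'v) \<Rightarrow> ('k \<Rightarrow> 'w::ab_group_add \<Rightarrow> 'w) \<Rightarrow>
   ('k \<Rightarrow> 'u::ab_group_add \<Rightarrow> 'u) \<Rightarrow> ('v \<Rightarrow> 'w \<Rightarrow> 'u) \<Rightarrow> bool" where
  "bilinear_map sV sW sU f \<longleftrightarrow>
     (\<forall>v. Vector_Spaces.linear sW sU (\<lambda>w. f v w)) \<and>
     (\<forall>w. Vector_Spaces.linear sV sU (\<lambda>v. f v w))"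

definition trilinear_map ::
  "('k::field \<Rightarrow> 'v::ab_group_add \<Rightarrow> 'v) \<Rightarrow> ('k \<Rightarrow> 'w::ab_group_add \<Rightarrow> 'w) \<Rightarrow>
   ('k \<Rightarrow> 'x::ab_group_add \<Rightarrow> 'x) \<Rightarrow> ('k \<Rightarrow> 'u::ab_group_add \<Rightarrow> 'u) \<Rightarrow>
   ('v \<Rightarrow> 'w \<Rightarrow> 'x \<Rightarrow> 'u) \<Rightarrow> bool" where
  "trilinear_map sV sW sX sU f \<longleftrightarrow>
     (\<forall>v w. Vector_Spaces.linear sX sU (\<lambda>x. f v w x)) \<and>
     (\<forall>v x. Vector_Spaces.linear sW sU (\<lambda>w. f v w x)) \<and>
     (\<forall>w x. Vector_Spaces.linear sV sU (\<lambda>v. f v w x))"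

type_synonym ('v, 'w, 'k) tensor2 = "('v \<Rightarrow> 'w \<Rightarrow> 'k) \<Rightarrow> 'k"
type_synonym ('v, 'w, 'x, 'k) tensor3 = "('v \<Rightarrow> 'w \<Rightarrow> 'x \<Rightarrow> 'k) \<Rightarrow> 'k"

definition pure2 ::
  "('k::field \<Rightarrow> 'v::ab_group_add \<Rightarrow> 'v) \<Rightarrow> ('k \<Rightarrow> 'w::ab_group_add \<Rightarrow> 'w) \<Rightarrow>
   'v \<Rightarrow> 'w \<Rightarrow> ('v, 'w, 'k) tensor2" where
  "pure2 sV sW v w = (\<lambda>f. if bilinear_map sV sW (*) f then f v w else 0)"

definition pure3 ::
  "('k::field \<Rightarrow> 'v::ab_group_add \<Rightarrow> 'v) \<Rightarrow> ('k \<Rightarrow> 'w::ab_group_add \<Rightarrow> 'w) \<Rightarrow>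
   ('k \<Rightarrow> 'x::ab_group_add \<Rightarrow> 'x) \<Rightarrow> 'v \<Rightarrow> 'w \<Rightarrow> 'x \<Rightarrow> ('v, 'w, 'x, 'k) tensor3" where
  "pure3 sV sW sX v w x = (\<lambda>f. if trilinear_map sV sW sX (*) f then f v w x else 0)"

definition tensor2_space ::
  "('k::field \<Rightarrow> 'v::ab_group_add \<Rightarrow> 'v) \<Rightarrow> ('k \<Rightarrow> 'w::ab_group_add \<Rightarrow> 'w) \<Rightarrow>
   ('v, 'w, 'k) tensor2 set" where
  "tensor2_space sV sW = module.span fscale {pure2 sV sW v w | v w. True}"

definition tensor3_space ::
  "('k::field \<Rightarrow> 'v::ab_group_add \<Rightarrow> 'v) \<Rightarrow> ('k \<Rightarrow> 'w::ab_group_add \<Rightarrow> 'w) \<Rightarrow>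
   ('k \<Rightarrow> 'x::ab_group_add \<Rightarrow> 'x) \<Rightarrow> ('v, 'w, 'x, 'k) tensor3 set" where
  "tensor3_space sV sW sX = module.span fscale {pure3 sV sW sX v w x | v w x. True}"

text \<open>
  The linear map on \<open>V \<otimes> W\<close> induced by a bilinear map \<open>g\<close>.  Only its values on
  \<^const>\<open>tensor2_space\<close> are determined (and meaningful); likewise for \<open>lift3\<close>.
\<close>

definition lift2 ::
  "('k::field \<Rightarrow> 'v::ab_group_add \<Rightarrow> 'v) \<Rightarrow> ('k \<Rightarrow> 'w::ab_group_add \<Rightarrow> 'w) \<Rightarrow>
   ('k \<Rightarrow> 'u::ab_group_add \<Rightarrow> 'u) \<Rightarrow> ('v \<Rightarrow> 'w \<Rightarrow> 'u) \<Rightarrow> ('v, 'w, 'k) tensor2 \<Rightarrow> 'u" where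
  "lift2 sV sW sU g =
     (SOME h. Vector_Spaces.linear fscale sU h \<and> (\<forall>v w. h (pure2 sV sW v w) = g v w))"

definition lift3 ::
  "('k::field \<Rightarrow> 'v::ab_group_add \<Rightarrow> 'v) \<Rightarrow> ('k \<Rightarrow> 'w::ab_group_add \<Rightarrow> 'w) \<Rightarrow>
   ('k \<Rightarrow> 'x::ab_group_add \<Rightarrow> 'x) \<Rightarrow> ('k \<Rightarrow> 'u::ab_group_add \<Rightarrow> 'u) \<Rightarrow>
   ('v \<Rightarrow> 'w \<Rightarrow> 'x \<Rightarrow> 'u) \<Rightarrow> ('v, 'w, 'x, 'k) tensor3 \<Rightarrow> 'u" where
  "lift3 sV sW sX sU g =
     (SOME h. Vector_Spaces.linear fscale sU h \<and>
              (\<forall>v w x. h (pure3 sV sW sX v w x) = g v w x))"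

subsection \<open>Universal property\<close>

lemma vector_space_fscale: "vector_space (fscale :: 'k::field \<Rightarrow> ('x \<Rightarrow> 'k) \<Rightarrow> 'x \<Rightarrow> 'k)"
  by unfold_locales (auto simp: fscale_def fun_eq_iff algebra_simps)

lemma vector_space_field: "vector_space ((*) :: 'k::field \<Rightarrow> 'k \<Rightarrow> 'k)"
  by unfold_locales (auto simp: algebra_simps)

lemma bilinear_map_pure2:
  assumes "vector_space sV" "vector_space sW"
  shows "bilinear_map sV sW fscale (pure2 sV sW)"
  using assms vector_space_fscale
  by (auto simp: bilinear_map_def pure2_def Vector_Spaces.linear_iff fscale_def fun_eq_iff)

lemma trilinear_map_pure3:
  assumes "vector_space sV" "vector_space sW" "vector_space sX"
  shows "trilinear_map sV sW sX fscale (pure3 sV sW sX)"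
  using assms vector_space_fscale
  by (auto simp: trilinear_map_def pure3_def Vector_Spaces.linear_iff fscale_def fun_eq_iff)

lemma vector_space_basis:
  assumes "vector_space s"
  obtains B where "\<not> module.dependent s B" "module.span s B = UNIV"
proof -
  interpret vector_space s by fact
  show ?thesis
    by (rule that[OF independent_extend_basis[OF independent_empty]
          span_extend_basis[OF independent_empty]])
qed

lemma dual_coordinate:
  assumes "vector_space s" "\<not> module.dependent s B" "module.span s B = UNIV" "b \<in> B"
  obtains f where "Vector_Spaces.linear s (*) f" "f b = 1" "\<And>b'. b' \<in> B \<Longrightarrow> b' \<noteq> b \<Longrightarrow> f b' = 0"
proof -
  interpret vector_space s by fact
  show ?thesis
    using that[of "\<lambda>v. representation B v b"] linear_representation[OF assms(2,3)]
      representation_basis[OF assms(2)] assms(4) by auto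
qed

lemma linear_eq_on_basis:
  assumes "Vector_Spaces.linear s t f" "Vector_Spaces.linear s t g"
    and "module.span s B = UNIV" "\<And>b. b \<in> B \<Longrightarrow> f b = g b"
  shows "f x = g x"
proof -
  interpret f: Vector_Spaces.linear s t f by fact
  interpret vector_space_pair s t by unfold_locales
  show ?thesis
    by (rule linear_eq_on[of f g x B]) (use assms in auto)
qed

lemma linear_comp:
  "Vector_Spaces.linear s1 s2 f \<Longrightarrow> Vector_Spaces.linear s2 s3 g \<Longrightarrow>
   Vector_Spaces.linear s1 s3 (\<lambda>x. g (f x))"
  using Vector_Spaces.linear_compose[of s1 s2 f s3 g] by (simp add: o_def)

lemma linear_extend_separated:
  fixes s :: "'k::field \<Rightarrow> 'v::ab_group_add \<Rightarrow> 'v" and t :: "'k \<Rightarrow> 'u::ab_group_add \<Rightarrow> 'u"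
    and e :: "'i \<Rightarrow> 'v" and g :: "'i \<Rightarrow> 'u"
  assumes vs: "vector_space s" and vt: "vector_space t"
    and sep: "\<And>i. i \<in> I \<Longrightarrow> \<exists>\<phi>. Vector_Spaces.linear s (*) \<phi> \<and> \<phi> (e i) = 1 \<and>
                 (\<forall>j\<in>I. j \<noteq> i \<longrightarrow> \<phi> (e j) = 0)"
  obtains h where "Vector_Spaces.linear s t h" "\<And>i. i \<in> I \<Longrightarrow> h (e i) = g i"
proof -
  interpret s: vector_space s by fact
  interpret t: vector_space t by fact
  interpret vector_space_pair s t by unfold_locales
  have inj: "inj_on e I"
    by (rule inj_onI) (metis sep zero_neq_one)
  have ind: "\<not> s.dependent (e ` I)"
  proof
    assume "s.dependent (e ` I)"
    then obtain i where i: "i \<in> I" "e i \<in> s.span (e ` I - {e i})"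
      unfolding s.dependent_def by auto
    obtain \<phi> where \<phi>: "Vector_Spaces.linear s (*) \<phi>" "\<phi> (e i) = 1"
        "\<forall>j\<in>I. j \<noteq> i \<longrightarrow> \<phi> (e j) = 0"
      using sep[OF i(1)] by blast
    interpret \<phi>: Vector_Spaces.linear s "(*)" \<phi> by fact
    have "\<phi> (e i) = 0"
      by (rule \<phi>.eq_0_on_span[OF _ i(2)]) (use \<phi>(3) in auto)
    with \<phi>(2) show False by simp
  qed
  obtain h where "Vector_Spaces.linear s t h" "\<forall>x\<in>e ` I. h x = g (the_inv_into I e x)"
    using linear_independent_extend[OF ind, of "\<lambda>x. g (the_inv_into I e x)"] by blast
  with that[of h] show ?thesis by (auto simp: the_inv_into_f_f[OF inj])
qed

lemma linear_eval:
  "Vector_Spaces.linear fscale (*) (\<lambda>\<phi> :: 'x \<Rightarrow> 'k::field. \<phi> f)"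
  using vector_space_fscale vector_space_field
  by (auto simp: Vector_Spaces.linear_iff fscale_def)

lemma lift2_exists:
  assumes V: "vector_space sV" and W: "vector_space sW" and U: "vector_space sU"
    and g: "bilinear_map sV sW sU g"
  shows "Vector_Spaces.linear fscale sU (lift2 sV sW sU g)"
    and "lift2 sV sW sU g (pure2 sV sW v w) = g v w"
proof -
  obtain B where B: "\<not> module.dependent sV B" "module.span sV B = UNIV"
    using vector_space_basis[OF V] by blast
  obtain B' where B': "\<not> module.dependent sW B'" "module.span sW B' = UNIV"
    using vector_space_basis[OF W] by blast
  have sep: "\<exists>\<phi>. Vector_Spaces.linear fscale (*) \<phi> \<and>
               \<phi> (pure2 sV sW (fst i) (snd i)) = 1 \<and>
               (\<forall>j\<in>B \<times> B'. j \<noteq> i \<longrightarrow> \<phi> (pure2 sV sW (fst j) (snd j)) = 0)"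
    if i: "i \<in> B \<times> B'" for i
  proof -
    obtain p where p: "Vector_Spaces.linear sV (*) p" "p (fst i) = 1"
        "\<And>b. b \<in> B \<Longrightarrow> b \<noteq> fst i \<Longrightarrow> p b = 0"
      by (rule dual_coordinate[OF V B, of "fst i"]) (use i in auto)
    obtain q where q: "Vector_Spaces.linear sW (*) q" "q (snd i) = 1"
        "\<And>b. b \<in> B' \<Longrightarrow> b \<noteq> snd i \<Longrightarrow> q b = 0"
      by (rule dual_coordinate[OF W B', of "snd i"]) (use i in auto)
    have "bilinear_map sV sW (*) (\<lambda>v w. p v * q w)"
      using p(1) q(1) by (auto simp: bilinear_map_def Vector_Spaces.linear_iff algebra_simps)
    with p q show ?thesis
      by (intro exI[of _ "\<lambda>\<phi>. \<phi> (\<lambda>v w. p v * q w)"] conjI linear_eval)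
         (auto simp: pure2_def prod_eq_iff)
  qed
  obtain h where h: "Vector_Spaces.linear fscale sU h"
      "\<And>i. i \<in> B \<times> B' \<Longrightarrow> h (pure2 sV sW (fst i) (snd i)) = g (fst i) (snd i)"
    using linear_extend_separated[OF vector_space_fscale U sep,
      where g = "\<lambda>i. g (fst i) (snd i)"] by blast
  have hb: "bilinear_map sV sW sU (\<lambda>v w. h (pure2 sV sW v w))"
    using bilinear_map_pure2[OF V W]
    unfolding bilinear_map_def by (auto intro!: linear_comp[OF _ h(1)])
  have 1: "h (pure2 sV sW v w) = g v w" if "v \<in> B" for v w
    by (rule linear_eq_on_basis[where f = "\<lambda>w. h (pure2 sV sW v w)" and g = "g v", OF _ _ B'(2)])
       (use hb g that h(2)[of "(v, _)"] in \<open>auto simp: bilinear_map_def\<close>)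
  have "h (pure2 sV sW v w) = g v w" for v w
    by (rule linear_eq_on_basis[where f = "\<lambda>v. h (pure2 sV sW v w)" and g = "\<lambda>v. g v w",
          OF _ _ B(2)])
       (use hb g 1 in \<open>auto simp: bilinear_map_def\<close>)
  with h(1) have "\<exists>h. Vector_Spaces.linear fscale sU h \<and> (\<forall>v w. h (pure2 sV sW v w) = g v w)"
    by blast
  from someI_ex[OF this]
  show "Vector_Spaces.linear fscale sU (lift2 sV sW sU g)"
    and "lift2 sV sW sU g (pure2 sV sW v w) = g v w"
    by (simp_all add: lift2_def)
qed

lemma lift3_exists:
  assumes V: "vector_space sV" and W: "vector_space sW" and X: "vector_space sX"
    and U: "vector_space sU" and g: "trilinear_map sV sW sX sU g"
  shows "Vector_Spaces.linear fscale sU (lift3 sV sW sX sU g)"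
    and "lift3 sV sW sX sU g (pure3 sV sW sX v w x) = g v w x"
proof -
  obtain B where B: "\<not> module.dependent sV B" "module.span sV B = UNIV"
    using vector_space_basis[OF V] by blast
  obtain B' where B': "\<not> module.dependent sW B'" "module.span sW B' = UNIV"
    using vector_space_basis[OF W] by blast
  obtain B'' where B'': "\<not> module.dependent sX B''" "module.span sX B'' = UNIV"
    using vector_space_basis[OF X] by blast
  let ?p = "\<lambda>i. pure3 sV sW sX (fst i) (fst (snd i)) (snd (snd i))"
  have sep: "\<exists>\<phi>. Vector_Spaces.linear fscale (*) \<phi> \<and> \<phi> (?p i) = 1 \<and>
               (\<forall>j\<in>B \<times> B' \<times> B''. j \<noteq> i \<longrightarrow> \<phi> (?p j) = 0)"
    if i: "i \<in> B \<times> B' \<times> B''" for i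
  proof -
    obtain p where p: "Vector_Spaces.linear sV (*) p" "p (fst i) = 1"
        "\<And>b. b \<in> B \<Longrightarrow> b \<noteq> fst i \<Longrightarrow> p b = 0"
      by (rule dual_coordinate[OF V B, of "fst i"]) (use i in auto)
    obtain q where q: "Vector_Spaces.linear sW (*) q" "q (fst (snd i)) = 1"
        "\<And>b. b \<in> B' \<Longrightarrow> b \<noteq> fst (snd i) \<Longrightarrow> q b = 0"
      by (rule dual_coordinate[OF W B', of "fst (snd i)"]) (use i in auto)
    obtain r where r: "Vector_Spaces.linear sX (*) r" "r (snd (snd i)) = 1"
        "\<And>b. b \<in> B'' \<Longrightarrow> b \<noteq> snd (snd i) \<Longrightarrow> r b = 0"
      by (rule dual_coordinate[OF X B'', of "snd (snd i)"]) (use i in auto)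
    have "trilinear_map sV sW sX (*) (\<lambda>v w x. p v * q w * r x)"
      using p(1) q(1) r(1)
      by (auto simp: trilinear_map_def Vector_Spaces.linear_iff algebra_simps)
    with p q r show ?thesis
      by (intro exI[of _ "\<lambda>\<phi>. \<phi> (\<lambda>v w x. p v * q w * r x)"] conjI linear_eval)
         (auto simp: pure3_def prod_eq_iff)
  qed
  obtain h where h: "Vector_Spaces.linear fscale sU h"
      "\<And>i. i \<in> B \<times> B' \<times> B'' \<Longrightarrow> h (?p i) = g (fst i) (fst (snd i)) (snd (snd i))"
    using linear_extend_separated[OF vector_space_fscale U sep,
      where g = "\<lambda>i. g (fst i) (fst (snd i)) (snd (snd i))"] by blast
  have ht: "trilinear_map sV sW sX sU (\<lambda>v w x. h (pure3 sV sW sX v w x))"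
    using trilinear_map_pure3[OF V W X]
    unfolding trilinear_map_def by (auto intro!: linear_comp[OF _ h(1)])
  have 1: "h (pure3 sV sW sX v w x) = g v w x" if "v \<in> B" "w \<in> B'" for v w x
    by (rule linear_eq_on_basis[where f = "\<lambda>x. h (pure3 sV sW sX v w x)" and g = "g v w",
          OF _ _ B''(2)])
       (use ht g that h(2)[of "(v, w, _)"] in \<open>auto simp: trilinear_map_def\<close>)
  have 2: "h (pure3 sV sW sX v w x) = g v w x" if "v \<in> B" for v w x
    by (rule linear_eq_on_basis[where f = "\<lambda>w. h (pure3 sV sW sX v w x)" and g = "\<lambda>w. g v w x",
          OF _ _ B'(2)])
       (use ht g that 1 in \<open>auto simp: trilinear_map_def\<close>)
  have "h (pure3 sV sW sX v w x) = g v w x" for v w x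
    by (rule linear_eq_on_basis[where f = "\<lambda>v. h (pure3 sV sW sX v w x)" and g = "\<lambda>v. g v w x",
          OF _ _ B(2)])
       (use ht g 2 in \<open>auto simp: trilinear_map_def\<close>)
  with h(1) have "\<exists>h. Vector_Spaces.linear fscale sU h \<and>
      (\<forall>v w x. h (pure3 sV sW sX v w x) = g v w x)"
    by blast
  from someI_ex[OF this]
  show "Vector_Spaces.linear fscale sU (lift3 sV sW sX sU g)"
    and "lift3 sV sW sX sU g (pure3 sV sW sX v w x) = g v w x"
    by (simp_all add: lift3_def)
qed

definition linear_map_on ::
  "('k::field \<Rightarrow> 'v::ab_group_add \<Rightarrow> 'v) \<Rightarrow> 'v set \<Rightarrow> ('k \<Rightarrow> 'u::ab_group_add \<Rightarrow> 'u) \<Rightarrow> 'u set \<Rightarrow>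
   ('v \<Rightarrow> 'u) \<Rightarrow> bool" where
  "linear_map_on s S t T f \<longleftrightarrow>
     (\<forall>x\<in>S. f x \<in> T) \<and>
     (\<forall>x\<in>S. \<forall>y\<in>S. f (x + y) = f x + f y) \<and>
     (\<forall>c. \<forall>x\<in>S. f (s c x) = t c (f x))"

lemma linear_map_on_span_eq:
  assumes "vector_space s" "vector_space t"
    and f: "linear_map_on s (module.span s G) t UNIV f"
    and g: "linear_map_on s (module.span s G) t UNIV g"
    and eq: "\<And>x. x \<in> G \<Longrightarrow> f x = g x" and x: "x \<in> module.span s G"
  shows "f x = g x"
proof -
  interpret s: vector_space s by fact
  interpret t: vector_space t by fact
  have "x \<in> s.span G \<and> f x = g x"
    using x
  proof (induction rule: s.span_induct_alt)
    case base
    have "f (s 0 0) = t 0 (f 0)" "g (s 0 0) = t 0 (g 0)"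
      using f g s.span_zero unfolding linear_map_on_def by blast+
    then show ?case by (simp add: s.span_zero)
  next
    case (step c x y)
    have sc: "s c x \<in> s.span G" and xs: "x \<in> s.span G"
      using step by (auto intro: s.span_scale s.span_base)
    have "f (s c x + y) = t c (f x) + f y" "g (s c x + y) = t c (g x) + g y"
      using f g sc xs step unfolding linear_map_on_def by auto
    with step eq sc show ?case by (simp add: s.span_add)
  qed
  then show ?thesis by simp
qed

lemma lift2_unique:
  assumes "vector_space sV" "vector_space sW" and U: "vector_space sU"
    and f: "linear_map_on fscale (tensor2_space sV sW) sU UNIV f"
    and g: "linear_map_on fscale (tensor2_space sV sW) sU UNIV g"
    and "\<And>v w. f (pure2 sV sW v w) = g (pure2 sV sW v w)" and "t \<in> tensor2_space sV sW"
  shows "f t = g t"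
  by (rule linear_map_on_span_eq[OF vector_space_fscale U f[unfolded tensor2_space_def]
        g[unfolded tensor2_space_def]])
     (use assms in \<open>auto simp: tensor2_space_def\<close>)

lemma lift3_unique:
  assumes "vector_space sV" "vector_space sW" "vector_space sX" and U: "vector_space sU"
    and f: "linear_map_on fscale (tensor3_space sV sW sX) sU UNIV f"
    and g: "linear_map_on fscale (tensor3_space sV sW sX) sU UNIV g"
    and "\<And>v w x. f (pure3 sV sW sX v w x) = g (pure3 sV sW sX v w x)"
    and "t \<in> tensor3_space sV sW sX"
  shows "f t = g t"
  by (rule linear_map_on_span_eq[OF vector_space_fscale U f[unfolded tensor3_space_def]
        g[unfolded tensor3_space_def]])
     (use assms in \<open>auto simp: tensor3_space_def\<close>)

subsection \<open>Linear maps between tensor products\<close>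

abbreviation linear_map2 where
  "linear_map2 sV sW sV' sW' f \<equiv>
     linear_map_on fscale (tensor2_space sV sW) fscale (tensor2_space sV' sW') f"

definition flip ::
  "('k::field \<Rightarrow> 'v::ab_group_add \<Rightarrow> 'v) \<Rightarrow> ('k \<Rightarrow> 'w::ab_group_add \<Rightarrow> 'w) \<Rightarrow>
   ('v, 'w, 'k) tensor2 \<Rightarrow> ('w, 'v, 'k) tensor2" where
  "flip sV sW = lift2 sV sW fscale (\<lambda>v w. pure2 sW sV w v)"

text \<open>
  For \<open>f : U \<otimes> V \<rightarrow> U' \<otimes> V'\<close>, the map \<open>f \<otimes> I : U \<otimes> V \<otimes> W \<rightarrow> U' \<otimes> V' \<otimes> W\<close>; similarly
  \<open>I \<otimes> f\<close> on the last two factors, and \<open>f\<close> on the first and third factor.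
\<close>

definition act12 ::
  "('k::field \<Rightarrow> 'u::ab_group_add \<Rightarrow> 'u) \<Rightarrow> ('k \<Rightarrow> 'v::ab_group_add \<Rightarrow> 'v) \<Rightarrow>
   ('k \<Rightarrow> 'u1::ab_group_add \<Rightarrow> 'u1) \<Rightarrow> ('k \<Rightarrow> 'v1::ab_group_add \<Rightarrow> 'v1) \<Rightarrow>
   ('k \<Rightarrow> 'w::ab_group_add \<Rightarrow> 'w) \<Rightarrow>
   (('u, 'v, 'k) tensor2 \<Rightarrow> ('u1, 'v1, 'k) tensor2) \<Rightarrow>
   ('u, 'v, 'w, 'k) tensor3 \<Rightarrow> ('u1, 'v1, 'w, 'k) tensor3" where
  "act12 sU sV sU' sV' sW f =
     lift3 sU sV sW fscale (\<lambda>u v w.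
       lift2 sU' sV' fscale (\<lambda>x y. pure3 sU' sV' sW x y w) (f (pure2 sU sV u v)))"

definition act23 ::
  "('k::field \<Rightarrow> 'u::ab_group_add \<Rightarrow> 'u) \<Rightarrow>
   ('k \<Rightarrow> 'v::ab_group_add \<Rightarrow> 'v) \<Rightarrow> ('k \<Rightarrow> 'w::ab_group_add \<Rightarrow> 'w) \<Rightarrow>
   ('k \<Rightarrow> 'v1::ab_group_add \<Rightarrow> 'v1) \<Rightarrow> ('k \<Rightarrow> 'w1::ab_group_add \<Rightarrow> 'w1) \<Rightarrow>
   (('v, 'w, 'k) tensor2 \<Rightarrow> ('v1, 'w1, 'k) tensor2) \<Rightarrow>
   ('u, 'v, 'w, 'k) tensor3 \<Rightarrow> ('u, 'v1, 'w1, 'k) tensor3" where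
  "act23 sU sV sW sV' sW' f =
     lift3 sU sV sW fscale (\<lambda>u v w.
       lift2 sV' sW' fscale (\<lambda>x y. pure3 sU sV' sW' u x y) (f (pure2 sV sW v w)))"

definition act13 ::
  "('k::field \<Rightarrow> 'u::ab_group_add \<Rightarrow> 'u) \<Rightarrow> ('k \<Rightarrow> 'v::ab_group_add \<Rightarrow> 'v) \<Rightarrow>
   ('k \<Rightarrow> 'w::ab_group_add \<Rightarrow> 'w) \<Rightarrow>
   (('u, 'w, 'k) tensor2 \<Rightarrow> ('u, 'w, 'k) tensor2) \<Rightarrow>
   ('u, 'v, 'w, 'k) tensor3 \<Rightarrow> ('u, 'v, 'w, 'k) tensor3" where
  "act13 sU sV sW f =
     lift3 sU sV sW fscale (\<lambda>u v w.
       lift2 sU sW fscale (\<lambda>x y. pure3 sU sV sW x v y) (f (pure2 sU sW u w)))"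

section \<open>Algebras and coalgebras\<close>

text \<open>
  The sort \<open>{ring, monoid_mult}\<close> is that of associative unital rings in which \<open>1 = 0\<close> is not
  excluded.
\<close>

locale k_algebra = vector_space sA
  for sA :: "'k::field \<Rightarrow> 'a::{ring, monoid_mult} \<Rightarrow> 'a" +
  assumes scale_mult_left: "sA c x * y = sA c (x * y)"
    and scale_mult_right: "x * sA c y = sA c (x * y)"

text \<open>\<open>\<mu> \<otimes> I : A \<otimes> A \<otimes> W \<rightarrow> A \<otimes> W\<close> and \<open>I \<otimes> \<mu> : W \<otimes> A \<otimes> A \<rightarrow> W \<otimes> A\<close>.\<close>

definition mult_left ::
  "('k::field \<Rightarrow> 'a::{ring, monoid_mult} \<Rightarrow> 'a) \<Rightarrow> ('k \<Rightarrow> 'w::ab_group_add \<Rightarrow> 'w) \<Rightarrow>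
   ('a, 'a, 'w, 'k) tensor3 \<Rightarrow> ('a, 'w, 'k) tensor2" where
  "mult_left sA sW = lift3 sA sA sW fscale (\<lambda>a b w. pure2 sA sW (a * b) w)"

definition mult_right ::
  "('k::field \<Rightarrow> 'w::ab_group_add \<Rightarrow> 'w) \<Rightarrow> ('k \<Rightarrow> 'a::{ring, monoid_mult} \<Rightarrow> 'a) \<Rightarrow>
   ('w, 'a, 'a, 'k) tensor3 \<Rightarrow> ('w, 'a, 'k) tensor2" where
  "mult_right sW sA = lift3 sW sA sA fscale (\<lambda>w a b. pure2 sW sA w (a * b))"

text \<open>\<open>\<Delta> \<otimes> I : C \<otimes> W \<rightarrow> C \<otimes> C \<otimes> W\<close> and \<open>I \<otimes> \<Delta> : W \<otimes> C \<rightarrow> W \<otimes> C \<otimes> C\<close>.\<close>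

definition comult_left ::
  "('k::field \<Rightarrow> 'c::ab_group_add \<Rightarrow> 'c) \<Rightarrow> ('k \<Rightarrow> 'w::ab_group_add \<Rightarrow> 'w) \<Rightarrow>
   ('c \<Rightarrow> ('c, 'c, 'k) tensor2) \<Rightarrow> ('c, 'w, 'k) tensor2 \<Rightarrow> ('c, 'c, 'w, 'k) tensor3" where
  "comult_left sC sW \<Delta> =
     lift2 sC sW fscale (\<lambda>c w. lift2 sC sC fscale (\<lambda>x y. pure3 sC sC sW x y w) (\<Delta> c))"

definition comult_right ::
  "('k::field \<Rightarrow> 'w::ab_group_add \<Rightarrow> 'w) \<Rightarrow> ('k \<Rightarrow> 'c::ab_group_add \<Rightarrow> 'c) \<Rightarrow>
   ('c \<Rightarrow> ('c, 'c, 'k) tensor2) \<Rightarrow> ('w, 'c, 'k) tensor2 \<Rightarrow> ('w, 'c, 'c, 'k) tensor3" where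
  "comult_right sW sC \<Delta> =
     lift2 sW sC fscale (\<lambda>w c. lift2 sC sC fscale (\<lambda>x y. pure3 sW sC sC w x y) (\<Delta> c))"

text \<open>
  \<open>\<epsilon> \<otimes> I : C \<otimes> W \<rightarrow> k \<otimes> W = W\<close> and \<open>I \<otimes> \<epsilon> : W \<otimes> C \<rightarrow> W \<otimes> k = W\<close>.
\<close>

definition counit_left ::
  "('k::field \<Rightarrow> 'c::ab_group_add \<Rightarrow> 'c) \<Rightarrow> ('k \<Rightarrow> 'w::ab_group_add \<Rightarrow> 'w) \<Rightarrow>
   ('c \<Rightarrow> 'k) \<Rightarrow> ('c, 'w, 'k) tensor2 \<Rightarrow> 'w" where
  "counit_left sC sW \<epsilon> = lift2 sC sW sW (\<lambda>c w. sW (\<epsilon> c) w)"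

definition counit_right ::
  "('k::field \<Rightarrow> 'w::ab_group_add \<Rightarrow> 'w) \<Rightarrow> ('k \<Rightarrow> 'c::ab_group_add \<Rightarrow> 'c) \<Rightarrow>
   ('c \<Rightarrow> 'k) \<Rightarrow> ('w, 'c, 'k) tensor2 \<Rightarrow> 'w" where
  "counit_right sW sC \<epsilon> = lift2 sW sC sW (\<lambda>w c. sW (\<epsilon> c) w)"

locale k_coalgebra = vector_space sC
  for sC :: "'k::field \<Rightarrow> 'c::ab_group_add \<Rightarrow> 'c"
    and \<Delta> :: "'c \<Rightarrow> ('c, 'c, 'k) tensor2"
    and \<epsilon> :: "'c \<Rightarrow> 'k" +
  assumes linear_comult: "linear_map_on sC UNIV fscale (tensor2_space sC sC) \<Delta>"
    and linear_counit: "Vector_Spaces.linear sC (*) \<epsilon>"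
    and coassoc: "comult_left sC sC \<Delta> (\<Delta> c) = comult_right sC sC \<Delta> (\<Delta> c)"
    and counit_left: "counit_left sC sC \<epsilon> (\<Delta> c) = c"
    and counit_right: "counit_right sC sC \<epsilon> (\<Delta> c) = c"

section \<open>Yang-Baxter systems\<close>

definition yb_commutator ::
  "('k::field \<Rightarrow> 'u::ab_group_add \<Rightarrow> 'u) \<Rightarrow> ('k \<Rightarrow> 'v::ab_group_add \<Rightarrow> 'v) \<Rightarrow>
   ('k \<Rightarrow> 'w::ab_group_add \<Rightarrow> 'w) \<Rightarrow>
   (('u, 'v, 'k) tensor2 \<Rightarrow> ('u, 'v, 'k) tensor2) \<Rightarrow>
   (('u, 'w, 'k) tensor2 \<Rightarrow> ('u, 'w, 'k) tensor2) \<Rightarrow>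
   (('v, 'w, 'k) tensor2 \<Rightarrow> ('v, 'w, 'k) tensor2) \<Rightarrow>
   ('u, 'v, 'w, 'k) tensor3 \<Rightarrow> ('u, 'v, 'w, 'k) tensor3" where
  "yb_commutator sU sV sW R S T x =
     (let R12 = act12 sU sV sU sV sW R;
          S13 = act13 sU sV sW S;
          T23 = act23 sU sV sW sV sW T
      in R12 (S13 (T23 x)) - T23 (S13 (R12 x)))"

definition yang_baxter_system ::
  "('k::field \<Rightarrow> 'v::ab_group_add \<Rightarrow> 'v) \<Rightarrow> ('k \<Rightarrow> 'w::ab_group_add \<Rightarrow> 'w) \<Rightarrow>
   (('v, 'v, 'k) tensor2 \<Rightarrow> ('v, 'v, 'k) tensor2) \<Rightarrow>
   (('v, 'w, 'k) tensor2 \<Rightarrow> ('v, 'w, 'k) tensor2) \<Rightarrow>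
   (('w, 'w, 'k) tensor2 \<Rightarrow> ('w, 'w, 'k) tensor2) \<Rightarrow> bool" where
  "yang_baxter_system sV sV' W X Z \<longleftrightarrow>
     linear_map2 sV sV sV sV W \<and> linear_map2 sV sV' sV sV' X \<and> linear_map2 sV' sV' sV' sV' Z \<and>
     (\<forall>x \<in> tensor3_space sV sV sV. yb_commutator sV sV sV W W W x = 0) \<and>
     (\<forall>x \<in> tensor3_space sV' sV' sV'. yb_commutator sV' sV' sV' Z Z Z x = 0) \<and>
     (\<forall>x \<in> tensor3_space sV sV sV'. yb_commutator sV sV sV' W X X x = 0) \<and>
     (\<forall>x \<in> tensor3_space sV sV' sV'. yb_commutator sV sV' sV' X X Z x = 0)"

definition W_map ::
  "('k::field \<Rightarrow> 'a::{ring, monoid_mult} \<Rightarrow> 'a) \<Rightarrow> 'k \<Rightarrow> 'k \<Rightarrow>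
   ('a, 'a, 'k) tensor2 \<Rightarrow> ('a, 'a, 'k) tensor2" where
  "W_map sA s r = lift2 sA sA fscale (\<lambda>a b.
     fscale s (pure2 sA sA (b * a) 1) + fscale r (pure2 sA sA 1 (b * a)) -
     fscale s (pure2 sA sA b a))"

definition Z_map ::
  "('k::field \<Rightarrow> 'c::ab_group_add \<Rightarrow> 'c) \<Rightarrow> ('c \<Rightarrow> ('c, 'c, 'k) tensor2) \<Rightarrow> ('c \<Rightarrow> 'k) \<Rightarrow>
   'k \<Rightarrow> 'k \<Rightarrow> ('c, 'c, 'k) tensor2 \<Rightarrow> ('c, 'c, 'k) tensor2" where
  "Z_map sC \<Delta> \<epsilon> t p = lift2 sC sC fscale (\<lambda>c d.
     fscale (t * \<epsilon> c) (\<Delta> d) + fscale (p * \<epsilon> d) (\<Delta> c) - fscale p (pure2 sC sC d c))"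

section \<open>Entwining maps\<close>

definition entwining ::
  "('k::field \<Rightarrow> 'a::{ring, monoid_mult} \<Rightarrow> 'a) \<Rightarrow> ('k \<Rightarrow> 'c::ab_group_add \<Rightarrow> 'c) \<Rightarrow>
   ('c \<Rightarrow> ('c, 'c, 'k) tensor2) \<Rightarrow> ('c \<Rightarrow> 'k) \<Rightarrow>
   (('c, 'a, 'k) tensor2 \<Rightarrow> ('a, 'c, 'k) tensor2) \<Rightarrow> bool" where
  "entwining sA sC \<Delta> \<epsilon> \<psi> \<longleftrightarrow>
     linear_map2 sC sA sA sC \<psi> \<and>
     (\<forall>x \<in> tensor3_space sC sA sA.
        \<psi> (mult_right sC sA x) =
        mult_left sA sC (act23 sA sC sA sA sC \<psi> (act12 sC sA sA sC sA \<psi> x))) \<and>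
     (\<forall>x \<in> tensor2_space sC sA.
        comult_right sA sC \<Delta> (\<psi> x) =
        act12 sC sA sA sC sC \<psi> (act23 sC sC sA sA sC \<psi> (comult_left sC sA \<Delta> x))) \<and>
     (\<forall>c. \<psi> (pure2 sC sA c 1) = pure2 sA sC 1 c) \<and>
     (\<forall>x \<in> tensor2_space sC sA. counit_right sA sC \<epsilon> (\<psi> x) = counit_left sC sA \<epsilon> x)"

end

theory Submission
  imports Defs
begin

text \<open>
  On the pure tensor \<open>a \<otimes> b \<otimes> c\<close> with \<open>a, b \<in> A\<close> and \<open>c \<in> C\<close>, the commutator \<open>[W, X, X]\<close> equals
  \<open>s P\<^sub>1\<^sub>3 + r P\<^sub>2\<^sub>3\<close>.  Here \<open>P \<in> A \<otimes> C\<close> is the difference of the two sides of the multiplicativity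
  axiom for \<open>\<psi> = X \<circ> \<tau>\<close>, evaluated at \<open>c \<otimes> b \<otimes> a\<close>, and the subscripts say that a unit is inserted
  into the missing factor (\<open>commutator_WXX\<close>); the normalisation \<open>X(1 \<otimes> c) = 1 \<otimes> c\<close> is what makes the
  unit terms of \<open>W\<close> pass through \<open>X\<close>.  Dually, on \<open>a \<otimes> c \<otimes> d\<close> the commutator \<open>[X, X, Z]\<close> equals
  \<open>t \<epsilon>(c) K(a, d) + p \<epsilon>(d) K(a, c)\<close>, where \<open>K(a, c)\<close> is the difference of the two sides of the
  comultiplicativity axiom at \<open>c \<otimes> a\<close> (\<open>commutator_XXZ\<close>).  The terms weighted by \<open>s\<close> and \<open>p\<close> that
  merely flip two factors cancel in both commutators.

  Hence both mixed commutators vanish if \<open>\<psi>\<close> is entwining.  Conversely, multiplying the two factors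
  in \<open>A\<close> turns \<open>s P\<^sub>1\<^sub>3 + r P\<^sub>2\<^sub>3 = 0\<close> into \<open>(s + r) P = 0\<close>.  If \<open>C \<noteq> 0\<close>, there is \<open>e\<close> with
  \<open>\<epsilon>(e) \<noteq> 0\<close>; taking \<open>c = d = e\<close> gives \<open>(t + p) \<epsilon>(e) K(a, e) = 0\<close>, and then taking \<open>c = e\<close> and
  \<open>d = e\<close> in turn gives \<open>(t + p) \<epsilon>(e) K(a, c) = 0\<close> for all \<open>c\<close>.  So both defects
  vanish as soon as \<open>s + r\<close> and \<open>t + p\<close> are nonzero, for instance if \<open>s = t = 1\<close> and
  \<open>r = p = 0\<close>.  The unit and counit axioms for
  \<open>\<psi>\<close> are the two normalisation hypotheses on \<open>X\<close>.

  The remaining commutators always vanish.  \<open>[W, W, W] = 0\<close> is a computation on pure tensors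
  (\<open>W_yang_baxter\<close>).  For \<open>[Z, Z, Z] = 0\<close>, the forms \<open>\<alpha> \<otimes> \<beta> \<otimes> \<gamma>\<close> separate the points of
  \<open>C \<otimes> C \<otimes> C\<close> (\<open>tensor3_separated\<close>), and the transpose of \<open>Z\<close> sends \<open>\<alpha> \<otimes> \<beta>\<close> to
  \<open>t \<epsilon> \<otimes> \<alpha>\<beta> + p \<alpha>\<beta> \<otimes> \<epsilon> - p \<beta> \<otimes> \<alpha>\<close> in terms of the dual algebra of \<open>C\<close> (\<open>act_Z_form\<close>),
  so this is again a computation in an associative unital algebra.
\<close>

section \<open>Linear and bilinear maps\<close>

lemma linear_vs: "Vector_Spaces.linear s t f \<Longrightarrow> vector_space t"
  by (auto simp: Vector_Spaces.linear_iff)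

lemma linear_rules:
  assumes "Vector_Spaces.linear s t f"
  shows linear_rule_add: "f (x + y) = f x + f y"
    and linear_rule_diff: "f (x - y) = f x - f y"
    and linear_rule_scale: "f (s c x) = t c (f x)"
    and linear_rule_zero: "f 0 = 0"
    and linear_rule_sum: "f (sum g I) = (\<Sum>i\<in>I. f (g i))"
proof -
  interpret Vector_Spaces.linear s t f by fact
  show "f (x + y) = f x + f y" "f (x - y) = f x - f y" "f (s c x) = t c (f x)" "f 0 = 0"
    "f (sum g I) = (\<Sum>i\<in>I. f (g i))"
    by (auto simp: add diff scale sum zero)
qed

lemma fscale_rules:
  fixes \<phi> \<psi> :: "'x \<Rightarrow> 'k::field" and g :: "'i \<Rightarrow> 'x \<Rightarrow> 'k"
  shows "fscale c (\<phi> + \<psi>) = fscale c \<phi> + fscale c \<psi>"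
  "fscale c (\<phi> - \<psi>) = fscale c \<phi> - fscale c \<psi>"
  "fscale c (fscale d \<phi>) = fscale (c * d) \<phi>"
  "fscale c (\<Sum>i\<in>I. g i) = (\<Sum>i\<in>I. fscale c (g i))"
proof -
  interpret vector_space "fscale :: 'k \<Rightarrow> ('x \<Rightarrow> 'k) \<Rightarrow> 'x \<Rightarrow> 'k" by (rule vector_space_fscale)
  show "fscale c (\<phi> + \<psi>) = fscale c \<phi> + fscale c \<psi>"
    "fscale c (\<phi> - \<psi>) = fscale c \<phi> - fscale c \<psi>"
    "fscale c (fscale d \<phi>) = fscale (c * d) \<phi>"
    "fscale c (\<Sum>i\<in>I. g i) = (\<Sum>i\<in>I. fscale c (g i))"
    by (simp_all add: scale_right_distrib scale_right_diff_distrib scale_sum_right)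
qed

lemma bilinear_slice:
  assumes "bilinear_map sV sW sU g"
  shows "Vector_Spaces.linear sV sU (\<lambda>v. g v w)" "Vector_Spaces.linear sW sU (g v)"
  using assms by (auto simp: bilinear_map_def)

lemma trilinear_slice:
  assumes "trilinear_map sV sW sX sU g"
  shows "Vector_Spaces.linear sV sU (\<lambda>v. g v w x)" "Vector_Spaces.linear sW sU (\<lambda>w. g v w x)"
    "Vector_Spaces.linear sX sU (g v w)"
  using assms by (auto simp: trilinear_map_def)

section \<open>Tensor spaces and maps out of them\<close>

lemma module_fscale: "module (fscale :: 'k::field \<Rightarrow> ('x \<Rightarrow> 'k) \<Rightarrow> 'x \<Rightarrow> 'k)"
  by unfold_locales (auto simp: fscale_def fun_eq_iff algebra_simps)

lemma subspace_tensor_spaces: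
  "module.subspace fscale (tensor2_space sV sW)"
  "module.subspace fscale (tensor3_space sV sW sX)"
  unfolding tensor2_space_def tensor3_space_def
  by (rule module.subspace_span[OF module_fscale])+

lemma subspace_fscale_rules:
  assumes "module.subspace (fscale :: 'k::field \<Rightarrow> ('x \<Rightarrow> 'k) \<Rightarrow> 'x \<Rightarrow> 'k) S"
  shows "0 \<in> S" "\<phi> \<in> S \<Longrightarrow> \<psi> \<in> S \<Longrightarrow> \<phi> + \<psi> \<in> S" "\<phi> \<in> S \<Longrightarrow> \<psi> \<in> S \<Longrightarrow> \<phi> - \<psi> \<in> S"
    "\<phi> \<in> S \<Longrightarrow> fscale c \<phi> \<in> S" "(\<And>i. i \<in> I \<Longrightarrow> g i \<in> S) \<Longrightarrow> sum g I \<in> S"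
proof -
  interpret vector_space "fscale :: 'k \<Rightarrow> ('x \<Rightarrow> 'k) \<Rightarrow> 'x \<Rightarrow> 'k" by (rule vector_space_fscale)
  show "0 \<in> S" "\<phi> \<in> S \<Longrightarrow> \<psi> \<in> S \<Longrightarrow> \<phi> + \<psi> \<in> S" "\<phi> \<in> S \<Longrightarrow> \<psi> \<in> S \<Longrightarrow> \<phi> - \<psi> \<in> S"
    "\<phi> \<in> S \<Longrightarrow> fscale c \<phi> \<in> S" "(\<And>i. i \<in> I \<Longrightarrow> g i \<in> S) \<Longrightarrow> sum g I \<in> S"
    by (rule subspace_0[OF assms] subspace_add[OF assms] subspace_diff[OF assms]
        subspace_scale[OF assms] subspace_sum[OF assms]; assumption)+
qed

lemmas tensor2_space_rules = subspace_fscale_rules[OF subspace_tensor_spaces(1)]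
lemmas tensor3_space_rules = subspace_fscale_rules[OF subspace_tensor_spaces(2)]

lemma pure2_in_tensor2_space: "pure2 sV sW v w \<in> tensor2_space sV sW"
  unfolding tensor2_space_def
  by (rule module.span_base[OF module_fscale]) blast

lemma pure3_in_tensor3_space: "pure3 sV sW sX v w x \<in> tensor3_space sV sW sX"
  unfolding tensor3_space_def
  by (rule module.span_base[OF module_fscale]) blast

lemma linear_eq_on_span:
  assumes "Vector_Spaces.linear s sU F" "Vector_Spaces.linear s sU G"
    and "\<And>x. x \<in> B \<Longrightarrow> F x = G x" and "t \<in> module.span s B"
  shows "F t = G t"
proof -
  interpret F: Vector_Spaces.linear s sU F by fact
  interpret vector_space_pair s sU by unfold_locales
  show ?thesis by (rule linear_eq_on[of F G t B]) (use assms in auto)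
qed

text \<open>
  These two lemmas differ from the uniqueness of lifts in that linearity is assumed on the whole
  ambient function space, where all maps defined by lifting are linear.
\<close>

lemma tensor2_ext:
  assumes "Vector_Spaces.linear fscale sU F" "Vector_Spaces.linear fscale sU G"
    and "\<And>v w. F (pure2 sV sW v w) = G (pure2 sV sW v w)" and "t \<in> tensor2_space sV sW"
  shows "F t = G t"
  by (rule linear_eq_on_span[OF assms(1,2) _ assms(4)[unfolded tensor2_space_def]])
     (use assms(3) in auto)

lemma tensor3_ext:
  assumes "Vector_Spaces.linear fscale sU F" "Vector_Spaces.linear fscale sU G"
    and "\<And>v w x. F (pure3 sV sW sX v w x) = G (pure3 sV sW sX v w x)"
    and "t \<in> tensor3_space sV sW sX"
  shows "F t = G t"
  by (rule linear_eq_on_span[OF assms(1,2) _ assms(4)[unfolded tensor3_space_def]])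
     (use assms(3) in auto)

lemma linear_maps_span_into:
  assumes F: "Vector_Spaces.linear s t F" and S: "module.subspace t S"
    and "\<And>x. x \<in> B \<Longrightarrow> F x \<in> S" and "x \<in> module.span s B"
  shows "F x \<in> S"
proof -
  interpret Vector_Spaces.linear s t F by fact
  have "F x \<in> F ` vs1.span B" using assms(4) by blast
  also have "\<dots> = vs2.span (F ` B)" by (simp add: span_image)
  also have "\<dots> \<subseteq> S" using assms(3) S by (intro vs2.span_minimal) auto
  finally show ?thesis .
qed

lemma tensor2_maps_into:
  assumes "Vector_Spaces.linear fscale fscale F" "module.subspace fscale S"
    and "\<And>v w. F (pure2 sV sW v w) \<in> S" and "t \<in> tensor2_space sV sW"
  shows "F t \<in> S"
  by (rule linear_maps_span_into[OF assms(1,2) _ assms(4)[unfolded tensor2_space_def]])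
     (use assms(3) in auto)

lemma tensor3_maps_into:
  assumes "Vector_Spaces.linear fscale fscale F" "module.subspace fscale S"
    and "\<And>v w x. F (pure3 sV sW sX v w x) \<in> S" and "t \<in> tensor3_space sV sW sX"
  shows "F t \<in> S"
  by (rule linear_maps_span_into[OF assms(1,2) _ assms(4)[unfolded tensor3_space_def]])
     (use assms(3) in auto)

lemma linear_map_onI:
  assumes "Vector_Spaces.linear s t F" "\<And>x. x \<in> S \<Longrightarrow> F x \<in> T"
  shows "linear_map_on s S t T F"
  using assms by (auto simp: linear_map_on_def linear_rules[OF assms(1)])

lemma pure2_linear:
  assumes "vector_space sV" "vector_space sW"
  shows "Vector_Spaces.linear sV fscale (\<lambda>v. pure2 sV sW v w)"
    and "Vector_Spaces.linear sW fscale (pure2 sV sW v)"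
  using bilinear_slice[OF bilinear_map_pure2[OF assms]] .

lemma pure3_linear:
  assumes "vector_space sV" "vector_space sW" "vector_space sX"
  shows "Vector_Spaces.linear sV fscale (\<lambda>v. pure3 sV sW sX v w x)"
    and "Vector_Spaces.linear sW fscale (\<lambda>w. pure3 sV sW sX v w x)"
    and "Vector_Spaces.linear sX fscale (pure3 sV sW sX v w)"
  using trilinear_slice[OF trilinear_map_pure3[OF assms]] .

text \<open>Scalars are absorbed into the first factor.\<close>

lemma tensor2_sum_of_pures:
  assumes V: "vector_space sV" and W: "vector_space sW" and t: "t \<in> tensor2_space sV sW"
  obtains n x y where "t = (\<Sum>i<(n::nat). pure2 sV sW (x i) (y i))"
proof -
  interpret vector_space "fscale :: 'a \<Rightarrow> (('b \<Rightarrow> 'c \<Rightarrow> 'a) \<Rightarrow> 'a) \<Rightarrow> _" by (rule vector_space_fscale)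
  note lin = linear_rule_scale[OF pure2_linear(1)[OF V W]]
  have "\<exists>n x y. t = (\<Sum>i<(n::nat). pure2 sV sW (x i) (y i))"
    using t unfolding tensor2_space_def
  proof (induction rule: span_induct_alt)
    case base
    show ?case by (rule exI[of _ 0]) simp
  next
    case (step c p t)
    then obtain v w n x y where p: "p = pure2 sV sW v w"
      and t: "t = (\<Sum>i<(n::nat). pure2 sV sW (x i) (y i))" by blast
    have "fscale c p + t =
        (\<Sum>i<Suc n. pure2 sV sW ((x(n := sV c v)) i) ((y(n := w)) i))"
      by (simp add: p t lin add.commute)
    then show ?case by blast
  qed
  then show ?thesis using that by blast
qed

lemma bilinear_map_on_pure2:
  assumes "vector_space sV" "vector_space sW" "vector_space sU"
    and f: "linear_map_on fscale (tensor2_space sV sW) sU T f"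
  shows "bilinear_map sV sW sU (\<lambda>v w. f (pure2 sV sW v w))"
  unfolding bilinear_map_def Vector_Spaces.linear_iff
  using assms(1-3) f pure2_in_tensor2_space[of sV sW]
  by (auto simp: linear_rules[OF pure2_linear(1)[OF assms(1,2)]]
      linear_rules[OF pure2_linear(2)[OF assms(1,2)]] linear_map_on_def)

section \<open>Inserting a tensor factor\<close>

text \<open>\<open>ins1 u\<close>, \<open>ins2 v\<close> and \<open>ins3 w\<close> turn a twofold tensor into a threefold one with the given
  vector as its first, second or third factor.\<close>

definition ins1 ::
  "('k::field \<Rightarrow> 'u::ab_group_add \<Rightarrow> 'u) \<Rightarrow> ('k \<Rightarrow> 'v::ab_group_add \<Rightarrow> 'v) \<Rightarrow>
   ('k \<Rightarrow> 'w::ab_group_add \<Rightarrow> 'w) \<Rightarrow> 'u \<Rightarrow> ('v, 'w, 'k) tensor2 \<Rightarrow> ('u, 'v, 'w, 'k) tensor3" where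
  "ins1 sU sV sW u = lift2 sV sW fscale (\<lambda>x y. pure3 sU sV sW u x y)"

definition ins2 ::
  "('k::field \<Rightarrow> 'u::ab_group_add \<Rightarrow> 'u) \<Rightarrow> ('k \<Rightarrow> 'v::ab_group_add \<Rightarrow> 'v) \<Rightarrow>
   ('k \<Rightarrow> 'w::ab_group_add \<Rightarrow> 'w) \<Rightarrow> 'v \<Rightarrow> ('u, 'w, 'k) tensor2 \<Rightarrow> ('u, 'v, 'w, 'k) tensor3" where
  "ins2 sU sV sW v = lift2 sU sW fscale (\<lambda>x y. pure3 sU sV sW x v y)"

definition ins3 ::
  "('k::field \<Rightarrow> 'u::ab_group_add \<Rightarrow> 'u) \<Rightarrow> ('k \<Rightarrow> 'v::ab_group_add \<Rightarrow> 'v) \<Rightarrow>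
   ('k \<Rightarrow> 'w::ab_group_add \<Rightarrow> 'w) \<Rightarrow> 'w \<Rightarrow> ('u, 'v, 'k) tensor2 \<Rightarrow> ('u, 'v, 'w, 'k) tensor3" where
  "ins3 sU sV sW w = lift2 sU sV fscale (\<lambda>x y. pure3 sU sV sW x y w)"

context
  fixes sU :: "'k::field \<Rightarrow> 'u::ab_group_add \<Rightarrow> 'u" and sV :: "'k \<Rightarrow> 'v::ab_group_add \<Rightarrow> 'v"
    and sW :: "'k \<Rightarrow> 'w::ab_group_add \<Rightarrow> 'w"
  assumes U: "vector_space sU" and V: "vector_space sV" and W: "vector_space sW"
begin

lemma pure3_bilinear:
  "bilinear_map sV sW fscale (\<lambda>x y. pure3 sU sV sW u x y)"
  "bilinear_map sU sW fscale (\<lambda>x y. pure3 sU sV sW x v y)"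
  "bilinear_map sU sV fscale (\<lambda>x y. pure3 sU sV sW x y w)"
  using pure3_linear[OF U V W] by (auto simp: bilinear_map_def)

lemma ins_linear:
  "Vector_Spaces.linear fscale fscale (ins1 sU sV sW u)"
  "Vector_Spaces.linear fscale fscale (ins2 sU sV sW v)"
  "Vector_Spaces.linear fscale fscale (ins3 sU sV sW w)"
  unfolding ins1_def ins2_def ins3_def
  by (rule lift2_exists; fact U V W vector_space_fscale pure3_bilinear)+

lemma ins_pure:
  "ins1 sU sV sW u (pure2 sV sW v w) = pure3 sU sV sW u v w"
  "ins2 sU sV sW v (pure2 sU sW u w) = pure3 sU sV sW u v w"
  "ins3 sU sV sW w (pure2 sU sV u v) = pure3 sU sV sW u v w"
  unfolding ins1_def ins2_def ins3_def
  by (rule lift2_exists; fact U V W vector_space_fscale pure3_bilinear)+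

lemma ins_in_space:
  "t1 \<in> tensor2_space sV sW \<Longrightarrow> ins1 sU sV sW u t1 \<in> tensor3_space sU sV sW"
  "t2 \<in> tensor2_space sU sW \<Longrightarrow> ins2 sU sV sW v t2 \<in> tensor3_space sU sV sW"
  "t3 \<in> tensor2_space sU sV \<Longrightarrow> ins3 sU sV sW w t3 \<in> tensor3_space sU sV sW"
  by (rule tensor2_maps_into[OF ins_linear(1) subspace_tensor_spaces(2)]
           tensor2_maps_into[OF ins_linear(2) subspace_tensor_spaces(2)]
           tensor2_maps_into[OF ins_linear(3) subspace_tensor_spaces(2)];
      simp add: ins_pure pure3_in_tensor3_space)+

text \<open>
  Linearity in the inserted vector needs the twofold tensor to lie in the tensor space: a lift is
  otherwise an unspecified linear extension.
\<close>

lemma ins_linear_param: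
  "t1 \<in> tensor2_space sV sW \<Longrightarrow> Vector_Spaces.linear sU fscale (\<lambda>u. ins1 sU sV sW u t1)"
  "t2 \<in> tensor2_space sU sW \<Longrightarrow> Vector_Spaces.linear sV fscale (\<lambda>v. ins2 sU sV sW v t2)"
  "t3 \<in> tensor2_space sU sV \<Longrightarrow> Vector_Spaces.linear sW fscale (\<lambda>w. ins3 sU sV sW w t3)"
proof -
  note sums = linear_rules(5)[OF ins_linear(1)] linear_rules(5)[OF ins_linear(2)]
    linear_rules(5)[OF ins_linear(3)]
  have sum_linear: "Vector_Spaces.linear s fscale (\<lambda>u. \<Sum>i<(n::nat). h u i)"
    if "vector_space s" "\<And>i. Vector_Spaces.linear s fscale (\<lambda>u. h u i)"
    for s :: "'k \<Rightarrow> 'x::ab_group_add \<Rightarrow> 'x" and n and h :: "'x \<Rightarrow> nat \<Rightarrow> ('y \<Rightarrow> 'k)"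
    using that by (auto simp: Vector_Spaces.linear_iff fscale_rules sum.distrib)
  show "Vector_Spaces.linear sU fscale (\<lambda>u. ins1 sU sV sW u t1)" if "t1 \<in> tensor2_space sV sW"
    by (rule tensor2_sum_of_pures[OF V W that])
       (simp add: sums ins_pure sum_linear U pure3_linear[OF U V W])
  show "Vector_Spaces.linear sV fscale (\<lambda>v. ins2 sU sV sW v t2)" if "t2 \<in> tensor2_space sU sW"
    by (rule tensor2_sum_of_pures[OF U W that])
       (simp add: sums ins_pure sum_linear V pure3_linear[OF U V W])
  show "Vector_Spaces.linear sW fscale (\<lambda>w. ins3 sU sV sW w t3)" if "t3 \<in> tensor2_space sU sV"
    by (rule tensor2_sum_of_pures[OF U V that])
       (simp add: sums ins_pure sum_linear W pure3_linear[OF U V W])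
qed

end

section \<open>Maps acting on two of three factors\<close>

lemma act12_rules:
  assumes U: "vector_space sU" and V: "vector_space sV" and U': "vector_space sU'"
    and V': "vector_space sV'" and W: "vector_space sW" and f: "linear_map2 sU sV sU' sV' f"
  shows "Vector_Spaces.linear fscale fscale (act12 sU sV sU' sV' sW f)"
    and "act12 sU sV sU' sV' sW f (pure3 sU sV sW u v w) = ins3 sU' sV' sW w (f (pure2 sU sV u v))"
    and "t \<in> tensor3_space sU sV sW \<Longrightarrow> act12 sU sV sU' sV' sW f t \<in> tensor3_space sU' sV' sW"
proof -
  have in_space: "f (pure2 sU sV u v) \<in> tensor2_space sU' sV'" for u v
    using f pure2_in_tensor2_space unfolding linear_map_on_def by blast
  note f_bil = bilinear_map_on_pure2[OF U V vector_space_fscale f]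
  have tri: "trilinear_map sU sV sW fscale (\<lambda>u v w. ins3 sU' sV' sW w (f (pure2 sU sV u v)))"
    unfolding trilinear_map_def
    using ins_linear_param(3)[OF U' V' W in_space]
      linear_comp[OF bilinear_slice(1)[OF f_bil] ins_linear(3)[OF U' V' W]]
      linear_comp[OF bilinear_slice(2)[OF f_bil] ins_linear(3)[OF U' V' W]] by blast
  show lin: "Vector_Spaces.linear fscale fscale (act12 sU sV sU' sV' sW f)"
    and pure: "act12 sU sV sU' sV' sW f (pure3 sU sV sW u v w) =
      ins3 sU' sV' sW w (f (pure2 sU sV u v))" for u v w
    using lift3_exists[OF U V W vector_space_fscale tri]
    by (auto simp: act12_def ins3_def)
  show "act12 sU sV sU' sV' sW f t \<in> tensor3_space sU' sV' sW" if "t \<in> tensor3_space sU sV sW"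
    by (rule tensor3_maps_into[OF lin subspace_tensor_spaces(2) _ that])
       (simp add: pure ins_in_space U' V' W in_space)
qed

lemma act23_rules:
  assumes U: "vector_space sU" and V: "vector_space sV" and W: "vector_space sW"
    and V': "vector_space sV'" and W': "vector_space sW'" and f: "linear_map2 sV sW sV' sW' f"
  shows "Vector_Spaces.linear fscale fscale (act23 sU sV sW sV' sW' f)"
    and "act23 sU sV sW sV' sW' f (pure3 sU sV sW u v w) = ins1 sU sV' sW' u (f (pure2 sV sW v w))"
    and "t \<in> tensor3_space sU sV sW \<Longrightarrow> act23 sU sV sW sV' sW' f t \<in> tensor3_space sU sV' sW'"
proof -
  have in_space: "f (pure2 sV sW v w) \<in> tensor2_space sV' sW'" for v w
    using f pure2_in_tensor2_space unfolding linear_map_on_def by blast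
  note f_bil = bilinear_map_on_pure2[OF V W vector_space_fscale f]
  have tri: "trilinear_map sU sV sW fscale (\<lambda>u v w. ins1 sU sV' sW' u (f (pure2 sV sW v w)))"
    unfolding trilinear_map_def
    using ins_linear_param(1)[OF U V' W' in_space]
      linear_comp[OF bilinear_slice(1)[OF f_bil] ins_linear(1)[OF U V' W']]
      linear_comp[OF bilinear_slice(2)[OF f_bil] ins_linear(1)[OF U V' W']] by blast
  show lin: "Vector_Spaces.linear fscale fscale (act23 sU sV sW sV' sW' f)"
    and pure: "act23 sU sV sW sV' sW' f (pure3 sU sV sW u v w) =
      ins1 sU sV' sW' u (f (pure2 sV sW v w))" for u v w
    using lift3_exists[OF U V W vector_space_fscale tri]
    by (auto simp: act23_def ins1_def)
  show "act23 sU sV sW sV' sW' f t \<in> tensor3_space sU sV' sW'" if "t \<in> tensor3_space sU sV sW"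
    by (rule tensor3_maps_into[OF lin subspace_tensor_spaces(2) _ that])
       (simp add: pure ins_in_space U V' W' in_space)
qed

lemma act13_rules:
  assumes U: "vector_space sU" and V: "vector_space sV" and W: "vector_space sW"
    and f: "linear_map2 sU sW sU sW f"
  shows "Vector_Spaces.linear fscale fscale (act13 sU sV sW f)"
    and "act13 sU sV sW f (pure3 sU sV sW u v w) = ins2 sU sV sW v (f (pure2 sU sW u w))"
    and "t \<in> tensor3_space sU sV sW \<Longrightarrow> act13 sU sV sW f t \<in> tensor3_space sU sV sW"
proof -
  have in_space: "f (pure2 sU sW u w) \<in> tensor2_space sU sW" for u w
    using f pure2_in_tensor2_space unfolding linear_map_on_def by blast
  note f_bil = bilinear_map_on_pure2[OF U W vector_space_fscale f]
  have tri: "trilinear_map sU sV sW fscale (\<lambda>u v w. ins2 sU sV sW v (f (pure2 sU sW u w)))"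
    unfolding trilinear_map_def
    using ins_linear_param(2)[OF U V W in_space]
      linear_comp[OF bilinear_slice(1)[OF f_bil] ins_linear(2)[OF U V W]]
      linear_comp[OF bilinear_slice(2)[OF f_bil] ins_linear(2)[OF U V W]] by blast
  show lin: "Vector_Spaces.linear fscale fscale (act13 sU sV sW f)"
    and pure: "act13 sU sV sW f (pure3 sU sV sW u v w) =
      ins2 sU sV sW v (f (pure2 sU sW u w))" for u v w
    using lift3_exists[OF U V W vector_space_fscale tri]
    by (auto simp: act13_def ins2_def)
  show "act13 sU sV sW f t \<in> tensor3_space sU sV sW" if "t \<in> tensor3_space sU sV sW"
    by (rule tensor3_maps_into[OF lin subspace_tensor_spaces(2) _ that])
       (simp add: pure ins_in_space U V W in_space)
qed

lemma flip_rules: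
  assumes V: "vector_space sV" and W: "vector_space sW"
  shows "Vector_Spaces.linear fscale fscale (flip sV sW)"
    and "flip sV sW (pure2 sV sW v w) = pure2 sW sV w v"
    and "t \<in> tensor2_space sV sW \<Longrightarrow> flip sV sW t \<in> tensor2_space sW sV"
proof -
  have bil: "bilinear_map sV sW fscale (\<lambda>v w. pure2 sW sV w v)"
    using pure2_linear[OF W V] by (auto simp: bilinear_map_def)
  note lift2_exists[OF V W vector_space_fscale bil]
  then show lin: "Vector_Spaces.linear fscale fscale (flip sV sW)"
    and pure: "flip sV sW (pure2 sV sW v w) = pure2 sW sV w v" for v w
    by (auto simp: flip_def)
  show "flip sV sW t \<in> tensor2_space sW sV" if "t \<in> tensor2_space sV sW"
    by (rule tensor2_maps_into[OF lin subspace_tensor_spaces(1) _ that])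
       (simp add: pure pure2_in_tensor2_space)
qed

section \<open>Pure tensors of linear forms separate points\<close>

text \<open>
  Finitely many vectors have coordinates in a common finite set \<open>B\<close>, and the coordinates are
  linear forms on the whole space.
\<close>

lemma vector_space_finite_coordinates:
  assumes "vector_space s" "finite S"
  obtains B r where "finite B" "\<And>b. Vector_Spaces.linear s (*) (r b)"
    "\<And>v. v \<in> S \<Longrightarrow> v = (\<Sum>b\<in>B. s (r b v) b)"
proof -
  interpret vector_space s by fact
  obtain B where B: "independent B" "span B = UNIV"
    using vector_space_basis[OF assms(1)] by blast
  define B0 where "B0 = (\<Union>v\<in>S. {b. representation B v b \<noteq> 0})"
  have fin: "finite B0"
    unfolding B0_def using assms(2) by (auto simp: finite_representation)
  have lin: "Vector_Spaces.linear s (*) (\<lambda>v. representation B v b)" for b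
    by (rule linear_representation[OF B])
  have "v = (\<Sum>b\<in>B0. s (representation B v b) b)" if "v \<in> S" for v
  proof -
    have "v = (\<Sum>b | representation B v b \<noteq> 0. s (representation B v b) b)"
      using sum_nonzero_representation_eq[OF B(1)] B(2) by simp
    also have "\<dots> = (\<Sum>b\<in>B0. s (representation B v b) b)"
      by (rule sum.mono_neutral_left[OF fin]) (use that in \<open>auto simp: B0_def\<close>)
    finally show ?thesis .
  qed
  with fin lin show ?thesis by (rule that[where r = "\<lambda>b v. representation B v b"])
qed

text \<open>The forms \<open>\<alpha> \<otimes> \<beta>\<close> and \<open>\<alpha> \<otimes> \<beta> \<otimes> \<gamma>\<close>, at which tensors are evaluated.\<close>

definition form2 :: "('v \<Rightarrow> 'k::field) \<Rightarrow> ('w \<Rightarrow> 'k) \<Rightarrow> 'v \<Rightarrow> 'w \<Rightarrow> 'k" where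
  "form2 \<alpha> \<beta> = (\<lambda>x y. \<alpha> x * \<beta> y)"

definition form3 :: "('v \<Rightarrow> 'k::field) \<Rightarrow> ('w \<Rightarrow> 'k) \<Rightarrow> ('x \<Rightarrow> 'k) \<Rightarrow> 'v \<Rightarrow> 'w \<Rightarrow> 'x \<Rightarrow> 'k" where
  "form3 \<alpha> \<beta> \<gamma> = (\<lambda>x y z. \<alpha> x * \<beta> y * \<gamma> z)"

lemma trilinear_form_prod:
  assumes "Vector_Spaces.linear sV (*) \<alpha>" "Vector_Spaces.linear sW (*) \<beta>"
    "Vector_Spaces.linear sX (*) \<gamma>"
  shows "trilinear_map sV sW sX (*) (form3 \<alpha> \<beta> \<gamma>)"
  using assms by (auto simp: form3_def trilinear_map_def Vector_Spaces.linear_iff algebra_simps)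

lemma bilinear_form_prod:
  assumes "Vector_Spaces.linear sV (*) \<alpha>" "Vector_Spaces.linear sW (*) \<beta>"
  shows "bilinear_map sV sW (*) (form2 \<alpha> \<beta>)"
  using assms by (auto simp: form2_def bilinear_map_def Vector_Spaces.linear_iff algebra_simps)

lemma tensor3_sum_of_pures:
  assumes V: "vector_space sV" and W: "vector_space sW" and X: "vector_space sX"
    and t: "t \<in> tensor3_space sV sW sX"
  obtains n x y z where "t = (\<Sum>i<(n::nat). pure3 sV sW sX (x i) (y i) (z i))"
proof -
  interpret vector_space "fscale :: 'a \<Rightarrow> (('b \<Rightarrow> 'c \<Rightarrow> 'd \<Rightarrow> 'a) \<Rightarrow> 'a) \<Rightarrow> _"
    by (rule vector_space_fscale)
  note lin = linear_rule_scale[OF pure3_linear(1)[OF V W X]]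
  have "\<exists>n x y z. t = (\<Sum>i<(n::nat). pure3 sV sW sX (x i) (y i) (z i))"
    using t unfolding tensor3_space_def
  proof (induction rule: span_induct_alt)
    case base
    show ?case by (rule exI[of _ 0]) simp
  next
    case (step c p t)
    then obtain u v w n x y z where p: "p = pure3 sV sW sX u v w"
      and t: "t = (\<Sum>i<(n::nat). pure3 sV sW sX (x i) (y i) (z i))" by blast
    have "fscale c p + t =
        (\<Sum>i<Suc n. pure3 sV sW sX ((x(n := sV c u)) i) ((y(n := v)) i) ((z(n := w)) i))"
      by (simp add: p t lin add.commute)
    then show ?case by blast
  qed
  then show ?thesis using that by blast
qed

lemma tensor3_separated:
  assumes V: "vector_space sV" and W: "vector_space sW" and X: "vector_space sX"
    and t: "t \<in> tensor3_space sV sW sX"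
    and zero: "\<And>\<alpha> \<beta> \<gamma>. Vector_Spaces.linear sV (*) \<alpha> \<Longrightarrow> Vector_Spaces.linear sW (*) \<beta> \<Longrightarrow>
      Vector_Spaces.linear sX (*) \<gamma> \<Longrightarrow> t (form3 \<alpha> \<beta> \<gamma>) = 0"
  shows "t = 0"
proof -
  obtain n x y z where t_eq: "t = (\<Sum>i<(n::nat). pure3 sV sW sX (x i) (y i) (z i))"
    by (rule tensor3_sum_of_pures[OF V W X t])
  have t_form: "t f = (\<Sum>i<n. f (x i) (y i) (z i))" if "trilinear_map sV sW sX (*) f" for f
    using that by (subst t_eq, subst linear_rule_sum[OF linear_eval]) (simp add: pure3_def)
  have t_form3: "t (form3 \<alpha> \<beta> \<gamma>) = (\<Sum>i<n. \<alpha> (x i) * \<beta> (y i) * \<gamma> (z i))"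
    if "Vector_Spaces.linear sV (*) \<alpha>" "Vector_Spaces.linear sW (*) \<beta>"
      "Vector_Spaces.linear sX (*) \<gamma>" for \<alpha> \<beta> \<gamma>
    using t_form[OF trilinear_form_prod[OF that]] by (simp only: form3_def)
  obtain B r where B: "finite B" "\<And>b. Vector_Spaces.linear sV (*) (r b)"
    "\<And>v. v \<in> x ` {..<n} \<Longrightarrow> v = (\<Sum>b\<in>B. sV (r b v) b)"
    by (rule vector_space_finite_coordinates[OF V finite_imageI[OF finite_lessThan[of n]], of x])
      (rule that; assumption)
  obtain B' r' where B': "finite B'" "\<And>b. Vector_Spaces.linear sW (*) (r' b)"
    "\<And>v. v \<in> y ` {..<n} \<Longrightarrow> v = (\<Sum>b\<in>B'. sW (r' b v) b)"
    by (rule vector_space_finite_coordinates[OF W finite_imageI[OF finite_lessThan[of n]], of y])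
      (rule that; assumption)
  obtain B'' r'' where B'': "finite B''" "\<And>b. Vector_Spaces.linear sX (*) (r'' b)"
    "\<And>v. v \<in> z ` {..<n} \<Longrightarrow> v = (\<Sum>b\<in>B''. sX (r'' b v) b)"
    by (rule vector_space_finite_coordinates[OF X finite_imageI[OF finite_lessThan[of n]], of z])
      (rule that; assumption)
  \<comment> \<open>Expanding in coordinates writes the value at a trilinear form as a combination of values at
    products of coordinate forms.\<close>
  have "t f = 0" if f: "trilinear_map sV sW sX (*) f" for f
  proof -
    note fl = trilinear_slice[OF f]
    have "f (x i) (y i) (z i) =
        (\<Sum>b\<in>B. \<Sum>b'\<in>B'. \<Sum>b''\<in>B''. f b b' b'' * (r b (x i) * r' b' (y i) * r'' b'' (z i)))"
      if "i < n" for i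
    proof -
      have "f (x i) (y i) (z i) = f (\<Sum>b\<in>B. sV (r b (x i)) b) (\<Sum>b\<in>B'. sW (r' b (y i)) b)
          (\<Sum>b\<in>B''. sX (r'' b (z i)) b)"
        using B(3)[of "x i"] B'(3)[of "y i"] B''(3)[of "z i"] that by simp
      also have "\<dots> =
        (\<Sum>b\<in>B. \<Sum>b'\<in>B'. \<Sum>b''\<in>B''. f b b' b'' * (r b (x i) * r' b' (y i) * r'' b'' (z i)))"
        by (simp only: linear_rules(3,5)[OF fl(1)], simp only: linear_rules(3,5)[OF fl(2)],
            simp only: linear_rules(3,5)[OF fl(3)]) (simp add: sum_distrib_left mult_ac)
      finally show ?thesis .
    qed
    then have "t f = (\<Sum>i<n. \<Sum>b\<in>B. \<Sum>b'\<in>B'. \<Sum>b''\<in>B''.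
        f b b' b'' * (r b (x i) * r' b' (y i) * r'' b'' (z i)))"
      by (simp add: t_form[OF f])
    also have "\<dots> = (\<Sum>b\<in>B. \<Sum>i<n. \<Sum>b'\<in>B'. \<Sum>b''\<in>B''.
        f b b' b'' * (r b (x i) * r' b' (y i) * r'' b'' (z i)))"
      by (rule sum.swap)
    also have "\<dots> = (\<Sum>b\<in>B. \<Sum>b'\<in>B'. \<Sum>i<n. \<Sum>b''\<in>B''.
        f b b' b'' * (r b (x i) * r' b' (y i) * r'' b'' (z i)))"
      by (intro sum.cong refl sum.swap)
    also have "\<dots> = (\<Sum>b\<in>B. \<Sum>b'\<in>B'. \<Sum>b''\<in>B''. \<Sum>i<n.
        f b b' b'' * (r b (x i) * r' b' (y i) * r'' b'' (z i)))"
      by (intro sum.cong refl sum.swap)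
    also have "\<dots> = (\<Sum>b\<in>B. \<Sum>b'\<in>B'. \<Sum>b''\<in>B''. f b b' b'' *
        t (form3 (r b) (r' b') (r'' b'')))"
      using B(2) B'(2) B''(2) by (simp add: t_form3 sum_distrib_left)
    also have "\<dots> = 0" using B(2) B'(2) B''(2) by (simp add: zero)
    finally show ?thesis .
  qed
  \<comment> \<open>Pure tensors are \<open>0\<close> by convention on functions that are not trilinear forms.\<close>
  moreover have "t f = 0" if "\<not> trilinear_map sV sW sX (*) f" for f
    using that by (subst t_eq, subst linear_rule_sum[OF linear_eval]) (simp add: pure3_def)
  ultimately show ?thesis by (metis ext zero_fun_apply)
qed


lemma pure2_form:
  assumes "Vector_Spaces.linear sV (*) \<alpha>" "Vector_Spaces.linear sW (*) \<beta>"
  shows "pure2 sV sW x y (form2 \<alpha> \<beta>) = \<alpha> x * \<beta> y"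
  using bilinear_form_prod[OF assms] by (simp add: pure2_def form2_def)

lemma pure3_form:
  assumes "Vector_Spaces.linear sV (*) \<alpha>" "Vector_Spaces.linear sW (*) \<beta>"
    "Vector_Spaces.linear sX (*) \<gamma>"
  shows "pure3 sV sW sX x y z (form3 \<alpha> \<beta> \<gamma>) = \<alpha> x * \<beta> y * \<gamma> z"
  using trilinear_form_prod[OF assms] by (simp add: pure3_def form3_def)

lemma linear_eval_times:
  "Vector_Spaces.linear fscale (*) (\<lambda>\<phi> :: 'x \<Rightarrow> 'k::field. k * \<phi> f)"
  using linear_eval[of f] by (auto simp: Vector_Spaces.linear_iff algebra_simps)

lemma ins_form:
  fixes sU :: "'k::field \<Rightarrow> 'u::ab_group_add \<Rightarrow> 'u" and sV :: "'k \<Rightarrow> 'v::ab_group_add \<Rightarrow> 'v"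
    and sW :: "'k \<Rightarrow> 'w::ab_group_add \<Rightarrow> 'w"
  assumes U: "vector_space sU" and V: "vector_space sV" and W: "vector_space sW"
    and f: "Vector_Spaces.linear sU (*) \<alpha>" "Vector_Spaces.linear sV (*) \<beta>"
      "Vector_Spaces.linear sW (*) \<gamma>"
  shows "t1 \<in> tensor2_space sV sW \<Longrightarrow>
      ins1 sU sV sW u t1 (form3 \<alpha> \<beta> \<gamma>) = \<alpha> u * t1 (form2 \<beta> \<gamma>)"
    and "t2 \<in> tensor2_space sU sW \<Longrightarrow>
      ins2 sU sV sW v t2 (form3 \<alpha> \<beta> \<gamma>) = \<beta> v * t2 (form2 \<alpha> \<gamma>)"
    and "t3 \<in> tensor2_space sU sV \<Longrightarrow>
      ins3 sU sV sW w t3 (form3 \<alpha> \<beta> \<gamma>) = \<gamma> w * t3 (form2 \<alpha> \<beta>)"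
proof -
  note ins = ins_linear[OF U V W]
  note lin = linear_comp[OF ins(1) linear_eval] linear_comp[OF ins(2) linear_eval]
    linear_comp[OF ins(3) linear_eval]
  note pure = ins_pure[OF U V W] pure3_form[OF f] pure2_form[OF f(1,2)] pure2_form[OF f(1,3)]
    pure2_form[OF f(2,3)]
  show "ins1 sU sV sW u t1 (form3 \<alpha> \<beta> \<gamma>) = \<alpha> u * t1 (form2 \<beta> \<gamma>)"
    if "t1 \<in> tensor2_space sV sW"
    by (rule tensor2_ext[OF lin(1) linear_eval_times _ that]) (simp add: pure)
  show "ins2 sU sV sW v t2 (form3 \<alpha> \<beta> \<gamma>) = \<beta> v * t2 (form2 \<alpha> \<gamma>)"
    if "t2 \<in> tensor2_space sU sW"
    by (rule tensor2_ext[OF lin(2) linear_eval_times _ that]) (simp add: pure)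
  show "ins3 sU sV sW w t3 (form3 \<alpha> \<beta> \<gamma>) = \<gamma> w * t3 (form2 \<alpha> \<beta>)"
    if "t3 \<in> tensor2_space sU sV"
    by (rule tensor2_ext[OF lin(3) linear_eval_times _ that]) (simp add: pure)
qed

section \<open>The Yang-Baxter commutator on pure tensors\<close>

lemma linear_zero: "Vector_Spaces.linear (fscale :: 'k::field \<Rightarrow> ('x \<Rightarrow> 'k) \<Rightarrow> 'x \<Rightarrow> 'k)
    (fscale :: 'k \<Rightarrow> ('y \<Rightarrow> 'k) \<Rightarrow> 'y \<Rightarrow> 'k) (\<lambda>_. 0)"
  by (simp add: Vector_Spaces.linear_iff vector_space_fscale) (simp add: fscale_def fun_eq_iff)

lemma linear_diff:
  assumes "Vector_Spaces.linear s t F" "Vector_Spaces.linear s t G"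
  shows "Vector_Spaces.linear s t (\<lambda>x. F x - G x)"
proof -
  interpret vector_space t by (rule linear_vs[OF assms(1)])
  show ?thesis using assms by (auto simp: Vector_Spaces.linear_iff scale_right_diff_distrib)
qed

lemma yb_commutator_rules:
  assumes U: "vector_space sU" and V: "vector_space sV" and W: "vector_space sW"
    and R: "linear_map2 sU sV sU sV R" and S: "linear_map2 sU sW sU sW S"
    and T: "linear_map2 sV sW sV sW T"
  shows "Vector_Spaces.linear fscale fscale (yb_commutator sU sV sW R S T)"
    and "t \<in> tensor3_space sU sV sW \<Longrightarrow> yb_commutator sU sV sW R S T t \<in> tensor3_space sU sV sW"
    and "(\<forall>x \<in> tensor3_space sU sV sW. yb_commutator sU sV sW R S T x = 0) \<longleftrightarrow>
      (\<forall>u v w. yb_commutator sU sV sW R S T (pure3 sU sV sW u v w) = 0)"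
proof -
  note act = act12_rules[OF U V U V W R] act13_rules[OF U V W S] act23_rules[OF U V W V W T]
  show lin: "Vector_Spaces.linear fscale fscale (yb_commutator sU sV sW R S T)"
    unfolding yb_commutator_def Let_def
    by (intro linear_diff linear_comp[OF _ act(1)] linear_comp[OF _ act(4)]
        linear_comp[OF _ act(7)] act(1,7))
  show "yb_commutator sU sV sW R S T t \<in> tensor3_space sU sV sW" if "t \<in> tensor3_space sU sV sW"
    unfolding yb_commutator_def Let_def
    by (intro tensor3_space_rules(3) act(3,6,9) that)
  show "(\<forall>x \<in> tensor3_space sU sV sW. yb_commutator sU sV sW R S T x = 0) \<longleftrightarrow>
      (\<forall>u v w. yb_commutator sU sV sW R S T (pure3 sU sV sW u v w) = 0)"
    using tensor3_ext[OF lin linear_zero]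
      pure3_in_tensor3_space by metis
qed

section \<open>The operator of an algebra\<close>

context k_algebra
begin

lemmas vs = vector_space_axioms

lemma W_bilinear:
  "bilinear_map sA sA fscale (\<lambda>a b. fscale s (pure2 sA sA (b * a) 1) +
     fscale r (pure2 sA sA 1 (b * a)) - fscale s (pure2 sA sA b a))"
  unfolding bilinear_map_def Vector_Spaces.linear_iff
  by (auto simp: vs vector_space_fscale distrib_left distrib_right scale_mult_left scale_mult_right
      linear_rules[OF pure2_linear(1)[OF vs vs]] linear_rules[OF pure2_linear(2)[OF vs vs]]
      fscale_rules mult.commute)

lemma W_map_rules:
  shows W_linear: "Vector_Spaces.linear fscale fscale (W_map sA s r)"
    and W_pure: "W_map sA s r (pure2 sA sA a b) = fscale s (pure2 sA sA (b * a) 1) +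
     fscale r (pure2 sA sA 1 (b * a)) - fscale s (pure2 sA sA b a)"
  using lift2_exists[OF vs vs vector_space_fscale W_bilinear] by (simp_all add: W_map_def)

lemma W_linear_map2: "linear_map2 sA sA sA sA (W_map sA s r)"
proof (rule linear_map_onI[OF W_linear])
  show "W_map sA s r t \<in> tensor2_space sA sA" if "t \<in> tensor2_space sA sA" for t
    by (rule tensor2_maps_into[OF W_linear subspace_tensor_spaces(1) _ that])
       (simp add: W_pure tensor2_space_rules pure2_in_tensor2_space)
qed

lemma W_yang_baxter:
  assumes "x \<in> tensor3_space sA sA sA"
  shows "yb_commutator sA sA sA (W_map sA s r) (W_map sA s r) (W_map sA s r) x = 0"
proof -
  note act = act12_rules[OF vs vs vs vs vs W_linear_map2] act13_rules[OF vs vs vs W_linear_map2]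
    act23_rules[OF vs vs vs vs vs W_linear_map2]
  note ins = ins_linear[OF vs vs vs]
  note lin = linear_rules[OF act(1)] linear_rules[OF act(4)] linear_rules[OF act(7)]
    linear_rules[OF ins(1)] linear_rules[OF ins(2)] linear_rules[OF ins(3)]
  have "yb_commutator sA sA sA (W_map sA s r) (W_map sA s r) (W_map sA s r) (pure3 sA sA sA a b c) = 0"
    for a b c
    unfolding yb_commutator_def Let_def
    by (simp add: lin act(2,5,8) ins_pure[OF vs vs vs] W_pure fscale_rules mult.assoc)
       (rule ext, simp add: fscale_def algebra_simps)
  then show ?thesis
    using yb_commutator_rules(3)[OF vs vs vs W_linear_map2 W_linear_map2 W_linear_map2] assms
    by blast
qed

end

section \<open>The operator of a coalgebra\<close>

context k_coalgebra
begin

lemmas vs = vector_space_axioms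

lemma comult_in_space: "\<Delta> c \<in> tensor2_space sC sC"
  using linear_comult by (simp add: linear_map_on_def)

lemma comult_linear: "Vector_Spaces.linear sC fscale \<Delta>"
  using linear_comult vs vector_space_fscale
  by (simp add: linear_map_on_def Vector_Spaces.linear_iff)

lemmas comult_rules = linear_rules[OF comult_linear]
lemmas counit_rules = linear_rules[OF linear_counit]

lemma comult_left_rules:
  fixes sW :: "'k \<Rightarrow> 'w::ab_group_add \<Rightarrow> 'w"
  assumes W: "vector_space sW"
  shows "Vector_Spaces.linear fscale fscale (comult_left sC sW \<Delta>)"
    and "comult_left sC sW \<Delta> (pure2 sC sW c w) = ins3 sC sC sW w (\<Delta> c)"
proof -
  have "bilinear_map sC sW fscale (\<lambda>c w. ins3 sC sC sW w (\<Delta> c))"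
    unfolding bilinear_map_def
    using ins_linear_param(3)[OF vs vs W comult_in_space]
      linear_comp[OF comult_linear ins_linear(3)[OF vs vs W]] by blast
  from lift2_exists[OF vs W vector_space_fscale this]
  show "Vector_Spaces.linear fscale fscale (comult_left sC sW \<Delta>)"
    and "comult_left sC sW \<Delta> (pure2 sC sW c w) = ins3 sC sC sW w (\<Delta> c)"
    by (auto simp: comult_left_def ins3_def)
qed

lemma comult_right_rules:
  fixes sW :: "'k \<Rightarrow> 'w::ab_group_add \<Rightarrow> 'w"
  assumes W: "vector_space sW"
  shows "Vector_Spaces.linear fscale fscale (comult_right sW sC \<Delta>)"
    and "comult_right sW sC \<Delta> (pure2 sW sC w c) = ins1 sW sC sC w (\<Delta> c)"
proof -
  have "bilinear_map sW sC fscale (\<lambda>w c. ins1 sW sC sC w (\<Delta> c))"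
    unfolding bilinear_map_def
    using ins_linear_param(1)[OF W vs vs comult_in_space]
      linear_comp[OF comult_linear ins_linear(1)[OF W vs vs]] by blast
  from lift2_exists[OF W vs vector_space_fscale this]
  show "Vector_Spaces.linear fscale fscale (comult_right sW sC \<Delta>)"
    and "comult_right sW sC \<Delta> (pure2 sW sC w c) = ins1 sW sC sC w (\<Delta> c)"
    by (auto simp: comult_right_def ins1_def)
qed

lemma counit_left_rules:
  fixes sW :: "'k \<Rightarrow> 'w::ab_group_add \<Rightarrow> 'w"
  assumes W: "vector_space sW"
  shows "Vector_Spaces.linear fscale sW (counit_left sC sW \<epsilon>)"
    and "counit_left sC sW \<epsilon> (pure2 sC sW c w) = sW (\<epsilon> c) w"
proof -
  interpret W: vector_space sW by (rule W)
  have "bilinear_map sC sW sW (\<lambda>c w. sW (\<epsilon> c) w)"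
    by (auto simp: bilinear_map_def Vector_Spaces.linear_iff vs W counit_rules
        W.scale_right_distrib W.scale_left_distrib mult.commute)
  from lift2_exists[OF vs W W this]
  show "Vector_Spaces.linear fscale sW (counit_left sC sW \<epsilon>)"
    and "counit_left sC sW \<epsilon> (pure2 sC sW c w) = sW (\<epsilon> c) w"
    by (auto simp: counit_left_def)
qed

lemma counit_right_rules:
  fixes sW :: "'k \<Rightarrow> 'w::ab_group_add \<Rightarrow> 'w"
  assumes W: "vector_space sW"
  shows "Vector_Spaces.linear fscale sW (counit_right sW sC \<epsilon>)"
    and "counit_right sW sC \<epsilon> (pure2 sW sC w c) = sW (\<epsilon> c) w"
proof -
  interpret W: vector_space sW by (rule W)
  have "bilinear_map sW sC sW (\<lambda>w c. sW (\<epsilon> c) w)"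
    by (auto simp: bilinear_map_def Vector_Spaces.linear_iff vs W counit_rules
        W.scale_right_distrib W.scale_left_distrib mult.commute)
  from lift2_exists[OF W vs W this]
  show "Vector_Spaces.linear fscale sW (counit_right sW sC \<epsilon>)"
    and "counit_right sW sC \<epsilon> (pure2 sW sC w c) = sW (\<epsilon> c) w"
    by (auto simp: counit_right_def)
qed

text \<open>The product of the dual algebra of \<open>C\<close>; its unit is \<open>\<epsilon>\<close>.\<close>

definition conv :: "('c \<Rightarrow> 'k) \<Rightarrow> ('c \<Rightarrow> 'k) \<Rightarrow> 'c \<Rightarrow> 'k" where
  "conv \<alpha> \<beta> c = \<Delta> c (form2 \<alpha> \<beta>)"

lemma conv_linear: "Vector_Spaces.linear sC (*) (conv \<alpha> \<beta>)"
  unfolding conv_def by (rule linear_comp[OF comult_linear linear_eval])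

lemma conv_counit_left:
  assumes "Vector_Spaces.linear sC (*) \<alpha>"
  shows "conv \<epsilon> \<alpha> = \<alpha>"
proof
  fix c
  have "\<alpha> (counit_left sC sC \<epsilon> (\<Delta> c)) = \<Delta> c (form2 \<epsilon> \<alpha>)"
    by (rule tensor2_ext[OF linear_comp[OF counit_left_rules(1)[OF vs] assms] linear_eval
          _ comult_in_space])
       (simp add: counit_left_rules[OF vs] pure2_form linear_counit assms linear_rules[OF assms])
  then show "conv \<epsilon> \<alpha> c = \<alpha> c" by (simp add: conv_def counit_left)
qed

lemma conv_counit_right:
  assumes "Vector_Spaces.linear sC (*) \<alpha>"
  shows "conv \<alpha> \<epsilon> = \<alpha>"
proof
  fix c
  have "\<alpha> (counit_right sC sC \<epsilon> (\<Delta> c)) = \<Delta> c (form2 \<alpha> \<epsilon>)"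
    by (rule tensor2_ext[OF linear_comp[OF counit_right_rules(1)[OF vs] assms] linear_eval
          _ comult_in_space])
       (simp add: counit_right_rules[OF vs] pure2_form linear_counit assms linear_rules[OF assms])
  then show "conv \<alpha> \<epsilon> c = \<alpha> c" by (simp add: conv_def counit_right)
qed

lemma conv_assoc:
  assumes "Vector_Spaces.linear sC (*) \<alpha>" "Vector_Spaces.linear sC (*) \<beta>"
    "Vector_Spaces.linear sC (*) \<gamma>"
  shows "conv (conv \<alpha> \<beta>) \<gamma> = conv \<alpha> (conv \<beta> \<gamma>)"
proof
  fix c
  have "comult_left sC sC \<Delta> (\<Delta> c) (form3 \<alpha> \<beta> \<gamma>) = \<Delta> c (form2 (conv \<alpha> \<beta>) \<gamma>)"
    by (rule tensor2_ext[OF linear_comp[OF comult_left_rules(1)[OF vs] linear_eval] linear_eval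
          _ comult_in_space])
       (simp add: comult_left_rules[OF vs] ins_form vs assms comult_in_space pure2_form conv_linear,
        simp add: conv_def)
  moreover have "comult_right sC sC \<Delta> (\<Delta> c) (form3 \<alpha> \<beta> \<gamma>) = \<Delta> c (form2 \<alpha> (conv \<beta> \<gamma>))"
    by (rule tensor2_ext[OF linear_comp[OF comult_right_rules(1)[OF vs] linear_eval] linear_eval
          _ comult_in_space])
       (simp add: comult_right_rules[OF vs] ins_form vs assms comult_in_space pure2_form conv_linear,
        simp add: conv_def)
  ultimately show "conv (conv \<alpha> \<beta>) \<gamma> c = conv \<alpha> (conv \<beta> \<gamma>) c"
    by (simp add: conv_def[of "conv \<alpha> \<beta>"] conv_def[of \<alpha> "conv \<beta> \<gamma>"] coassoc)
qed

lemma Z_bilinear: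
  "bilinear_map sC sC fscale (\<lambda>c d. fscale (t * \<epsilon> c) (\<Delta> d) + fscale (p * \<epsilon> d) (\<Delta> c) -
     fscale p (pure2 sC sC d c))"
  unfolding bilinear_map_def Vector_Spaces.linear_iff
  by (auto simp: vs vector_space_fscale linear_rules[OF pure2_linear(1)[OF vs vs]]
      linear_rules[OF pure2_linear(2)[OF vs vs]] comult_rules counit_rules)
     (auto simp: fun_eq_iff fscale_def algebra_simps)

lemma Z_map_rules:
  shows Z_linear: "Vector_Spaces.linear fscale fscale (Z_map sC \<Delta> \<epsilon> t p)"
    and Z_pure: "Z_map sC \<Delta> \<epsilon> t p (pure2 sC sC c d) = fscale (t * \<epsilon> c) (\<Delta> d) +
     fscale (p * \<epsilon> d) (\<Delta> c) - fscale p (pure2 sC sC d c)"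
  using lift2_exists[OF vs vs vector_space_fscale Z_bilinear] by (simp_all add: Z_map_def)

lemma Z_linear_map2: "linear_map2 sC sC sC sC (Z_map sC \<Delta> \<epsilon> t p)"
proof (rule linear_map_onI[OF Z_linear])
  show "Z_map sC \<Delta> \<epsilon> t p u \<in> tensor2_space sC sC" if "u \<in> tensor2_space sC sC" for u
    by (rule tensor2_maps_into[OF Z_linear subspace_tensor_spaces(1) _ that])
       (simp add: Z_pure tensor2_space_rules pure2_in_tensor2_space comult_in_space)
qed

lemma Z_form:
  assumes "Vector_Spaces.linear sC (*) \<alpha>" "Vector_Spaces.linear sC (*) \<beta>"
  shows "Z_map sC \<Delta> \<epsilon> t p (pure2 sC sC c d) (form2 \<alpha> \<beta>) =
    t * \<epsilon> c * conv \<alpha> \<beta> d + p * \<epsilon> d * conv \<alpha> \<beta> c - p * \<alpha> d * \<beta> c"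
  by (simp add: Z_pure pure2_form assms conv_def fscale_def)

text \<open>
  The transpose of \<open>Z\<close> is \<open>\<alpha> \<otimes> \<beta> \<mapsto> t \<epsilon> \<otimes> \<alpha>\<beta> + p \<alpha>\<beta> \<otimes> \<epsilon> - p \<beta> \<otimes> \<alpha>\<close>, an operator of the type of
  \<open>W\<close> for the dual algebra; here it acts on each pair of factors.
\<close>

lemma act_Z_form:
  assumes f: "Vector_Spaces.linear sC (*) \<alpha>" "Vector_Spaces.linear sC (*) \<beta>"
    "Vector_Spaces.linear sC (*) \<gamma>" and u: "u \<in> tensor3_space sC sC sC"
  shows "act12 sC sC sC sC sC (Z_map sC \<Delta> \<epsilon> t p) u (form3 \<alpha> \<beta> \<gamma>) =
      t * u (form3 \<epsilon> (conv \<alpha> \<beta>) \<gamma>) + p * u (form3 (conv \<alpha> \<beta>) \<epsilon> \<gamma>) - p * u (form3 \<beta> \<alpha> \<gamma>)"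
    and "act13 sC sC sC (Z_map sC \<Delta> \<epsilon> t p) u (form3 \<alpha> \<beta> \<gamma>) =
      t * u (form3 \<epsilon> \<beta> (conv \<alpha> \<gamma>)) + p * u (form3 (conv \<alpha> \<gamma>) \<beta> \<epsilon>) - p * u (form3 \<gamma> \<beta> \<alpha>)"
    and "act23 sC sC sC sC sC (Z_map sC \<Delta> \<epsilon> t p) u (form3 \<alpha> \<beta> \<gamma>) =
      t * u (form3 \<alpha> \<epsilon> (conv \<beta> \<gamma>)) + p * u (form3 \<alpha> (conv \<beta> \<gamma>) \<epsilon>) - p * u (form3 \<alpha> \<gamma> \<beta>)"
proof -
  note act = act12_rules[OF vs vs vs vs vs Z_linear_map2] act13_rules[OF vs vs vs Z_linear_map2]
    act23_rules[OF vs vs vs vs vs Z_linear_map2]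
  have lin: "Vector_Spaces.linear fscale (*) (\<lambda>u :: ('c, 'c, 'c, 'k) tensor3. t * u F + p * u G - p * u H)"
    for F G H
    using vector_space_fscale vector_space_field
    by (auto simp: Vector_Spaces.linear_iff fscale_def algebra_simps)
  have in_space: "Z_map sC \<Delta> \<epsilon> t p (pure2 sC sC c d) \<in> tensor2_space sC sC" for c d
    using Z_linear_map2 pure2_in_tensor2_space unfolding linear_map_on_def by blast
  note simps = act(2,5,8) ins_form[OF vs vs vs f] in_space Z_form f pure3_form conv_linear
    linear_counit algebra_simps
  show "act12 sC sC sC sC sC (Z_map sC \<Delta> \<epsilon> t p) u (form3 \<alpha> \<beta> \<gamma>) =
      t * u (form3 \<epsilon> (conv \<alpha> \<beta>) \<gamma>) + p * u (form3 (conv \<alpha> \<beta>) \<epsilon> \<gamma>) - p * u (form3 \<beta> \<alpha> \<gamma>)"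
    by (rule tensor3_ext[OF linear_comp[OF act(1) linear_eval] lin _ u]) (simp add: simps)
  show "act13 sC sC sC (Z_map sC \<Delta> \<epsilon> t p) u (form3 \<alpha> \<beta> \<gamma>) =
      t * u (form3 \<epsilon> \<beta> (conv \<alpha> \<gamma>)) + p * u (form3 (conv \<alpha> \<gamma>) \<beta> \<epsilon>) - p * u (form3 \<gamma> \<beta> \<alpha>)"
    by (rule tensor3_ext[OF linear_comp[OF act(4) linear_eval] lin _ u]) (simp add: simps)
  show "act23 sC sC sC sC sC (Z_map sC \<Delta> \<epsilon> t p) u (form3 \<alpha> \<beta> \<gamma>) =
      t * u (form3 \<alpha> \<epsilon> (conv \<beta> \<gamma>)) + p * u (form3 \<alpha> (conv \<beta> \<gamma>) \<epsilon>) - p * u (form3 \<alpha> \<gamma> \<beta>)"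
    by (rule tensor3_ext[OF linear_comp[OF act(7) linear_eval] lin _ u]) (simp add: simps)
qed

lemma Z_yang_baxter:
  assumes x: "x \<in> tensor3_space sC sC sC"
  shows "yb_commutator sC sC sC (Z_map sC \<Delta> \<epsilon> t p) (Z_map sC \<Delta> \<epsilon> t p) (Z_map sC \<Delta> \<epsilon> t p) x = 0"
proof (rule tensor3_separated[OF vs vs vs])
  note act = act12_rules(3)[OF vs vs vs vs vs Z_linear_map2] act13_rules(3)[OF vs vs vs Z_linear_map2]
    act23_rules(3)[OF vs vs vs vs vs Z_linear_map2]
  show "yb_commutator sC sC sC (Z_map sC \<Delta> \<epsilon> t p) (Z_map sC \<Delta> \<epsilon> t p) (Z_map sC \<Delta> \<epsilon> t p) x
      \<in> tensor3_space sC sC sC"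
    by (rule yb_commutator_rules(2)[OF vs vs vs Z_linear_map2 Z_linear_map2 Z_linear_map2 x])
  fix \<alpha> \<beta> \<gamma>
  assume f: "Vector_Spaces.linear sC (*) \<alpha>" "Vector_Spaces.linear sC (*) \<beta>"
    "Vector_Spaces.linear sC (*) \<gamma>"
  show "yb_commutator sC sC sC (Z_map sC \<Delta> \<epsilon> t p) (Z_map sC \<Delta> \<epsilon> t p) (Z_map sC \<Delta> \<epsilon> t p) x
      (form3 \<alpha> \<beta> \<gamma>) = 0"
    unfolding yb_commutator_def Let_def
    by (simp add: act_Z_form f act x conv_linear linear_counit conv_assoc conv_counit_left
        conv_counit_right algebra_simps)
qed

end

section \<open>Entwining defects\<close>

lemma linear_map_on_comp:
  assumes "linear_map_on s S t T f" "linear_map_on t T u U g"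
  shows "linear_map_on s S u U (\<lambda>x. g (f x))"
  using assms unfolding linear_map_on_def by simp

lemma linear_map_on_UNIV: "linear_map_on s S t T f \<Longrightarrow> linear_map_on s S t UNIV f"
  unfolding linear_map_on_def by blast

lemma mult_left_rules:
  fixes sA :: "'k::field \<Rightarrow> 'a::{ring, monoid_mult} \<Rightarrow> 'a" and sW :: "'k \<Rightarrow> 'w::ab_group_add \<Rightarrow> 'w"
  assumes A: "k_algebra sA" and W: "vector_space sW"
  shows "Vector_Spaces.linear fscale fscale (mult_left sA sW)"
    and "mult_left sA sW (pure3 sA sA sW a b w) = pure2 sA sW (a * b) w"
    and "t \<in> tensor3_space sA sA sW \<Longrightarrow> mult_left sA sW t \<in> tensor2_space sA sW"
proof -
  interpret A: k_algebra sA by (rule A)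
  have "trilinear_map sA sA sW fscale (\<lambda>a b w. pure2 sA sW (a * b) w)"
    by (auto simp: trilinear_map_def Vector_Spaces.linear_iff A.vs W vector_space_fscale
        distrib_left distrib_right A.scale_mult_left A.scale_mult_right
        linear_rules[OF pure2_linear(1)[OF A.vs W]] linear_rules[OF pure2_linear(2)[OF A.vs W]])
  from lift3_exists[OF A.vs A.vs W vector_space_fscale this]
  show lin: "Vector_Spaces.linear fscale fscale (mult_left sA sW)"
    and pure: "mult_left sA sW (pure3 sA sA sW a b w) = pure2 sA sW (a * b) w" for a b w
    by (auto simp: mult_left_def)
  show "mult_left sA sW t \<in> tensor2_space sA sW" if "t \<in> tensor3_space sA sA sW"
    by (rule tensor3_maps_into[OF lin subspace_tensor_spaces(1) _ that])
       (simp add: pure pure2_in_tensor2_space)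
qed

lemma mult_right_rules:
  fixes sA :: "'k::field \<Rightarrow> 'a::{ring, monoid_mult} \<Rightarrow> 'a" and sW :: "'k \<Rightarrow> 'w::ab_group_add \<Rightarrow> 'w"
  assumes A: "k_algebra sA" and W: "vector_space sW"
  shows "Vector_Spaces.linear fscale fscale (mult_right sW sA)"
    and "mult_right sW sA (pure3 sW sA sA w a b) = pure2 sW sA w (a * b)"
    and "t \<in> tensor3_space sW sA sA \<Longrightarrow> mult_right sW sA t \<in> tensor2_space sW sA"
proof -
  interpret A: k_algebra sA by (rule A)
  have "trilinear_map sW sA sA fscale (\<lambda>w a b. pure2 sW sA w (a * b))"
    by (auto simp: trilinear_map_def Vector_Spaces.linear_iff A.vs W vector_space_fscale
        distrib_left distrib_right A.scale_mult_left A.scale_mult_right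
        linear_rules[OF pure2_linear(1)[OF W A.vs]] linear_rules[OF pure2_linear(2)[OF W A.vs]])
  from lift3_exists[OF W A.vs A.vs vector_space_fscale this]
  show lin: "Vector_Spaces.linear fscale fscale (mult_right sW sA)"
    and pure: "mult_right sW sA (pure3 sW sA sA w a b) = pure2 sW sA w (a * b)" for w a b
    by (auto simp: mult_right_def)
  show "mult_right sW sA t \<in> tensor2_space sW sA" if "t \<in> tensor3_space sW sA sA"
    by (rule tensor3_maps_into[OF lin subspace_tensor_spaces(1) _ that])
       (simp add: pure pure2_in_tensor2_space)
qed

text \<open>An algebra, a coalgebra, and a normalised linear map \<open>X\<close> as in the theorem.\<close>

locale entwining_candidate = A: k_algebra sA + C: k_coalgebra sC \<Delta> \<epsilon>
  for sA :: "'k::field \<Rightarrow> 'a::{ring, monoid_mult} \<Rightarrow> 'a"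
    and sC :: "'k \<Rightarrow> 'c::ab_group_add \<Rightarrow> 'c"
    and \<Delta> :: "'c \<Rightarrow> ('c, 'c, 'k) tensor2" and \<epsilon> :: "'c \<Rightarrow> 'k" +
  fixes X :: "('a, 'c, 'k) tensor2 \<Rightarrow> ('a, 'c, 'k) tensor2"
  assumes X_linear: "linear_map2 sA sC sA sC X"
    and X_unit: "X (pure2 sA sC 1 c) = pure2 sA sC 1 c"
    and X_counit: "x \<in> tensor2_space sA sC \<Longrightarrow>
      counit_right sA sC \<epsilon> (X x) = counit_right sA sC \<epsilon> x"
begin

text \<open>The candidate entwining map \<open>X \<circ> \<tau>\<close>.\<close>

definition \<psi> :: "('c, 'a, 'k) tensor2 \<Rightarrow> ('a, 'c, 'k) tensor2" where
  "\<psi> = X \<circ> flip sC sA"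

lemma \<psi>_pure: "\<psi> (pure2 sC sA c a) = X (pure2 sA sC a c)"
  by (simp add: \<psi>_def flip_rules(2) A.vs C.vs)

lemma \<psi>_linear_map2: "linear_map2 sC sA sA sC \<psi>"
  unfolding \<psi>_def o_def
  by (rule linear_map_on_comp[OF linear_map_onI X_linear]) (simp_all add: flip_rules A.vs C.vs)

lemma X_in_space: "X (pure2 sA sC a c) \<in> tensor2_space sA sC"
  using X_linear pure2_in_tensor2_space unfolding linear_map_on_def by blast

lemma X_bilinear: "bilinear_map sA sC fscale (\<lambda>a c. X (pure2 sA sC a c))"
  by (rule bilinear_map_on_pure2[OF A.vs C.vs vector_space_fscale X_linear])

text \<open>
  A simultaneous choice of representations \<open>X (a \<otimes> c) = \<Sum>\<^sub>i l\<^sub>i \<otimes> r\<^sub>i\<close>, so that composites of \<open>X\<close>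
  acting on different factors become explicit iterated sums.
\<close>

lemma X_sum_of_pures:
  obtains n :: "'a \<Rightarrow> 'c \<Rightarrow> nat" and l r
  where "\<And>a c. X (pure2 sA sC a c) = (\<Sum>i<n a c. pure2 sA sC (l a c i) (r a c i))"
proof -
  have "\<exists>q. X (pure2 sA sC a c) = (\<Sum>i<(fst q :: nat). pure2 sA sC (fst (snd q) i) (snd (snd q) i))"
    for a c
    by (rule tensor2_sum_of_pures[OF A.vs C.vs X_in_space[of a c]]) auto
  then have "\<forall>a. \<exists>q. \<forall>c. X (pure2 sA sC a c) =
      (\<Sum>i<(fst (q c) :: nat). pure2 sA sC (fst (snd (q c)) i) (snd (snd (q c)) i))"
    by (intro allI choice)
  from choice[OF this] obtain q where q: "\<And>a c. X (pure2 sA sC a c) =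
      (\<Sum>i<(fst (q a c) :: nat). pure2 sA sC (fst (snd (q a c)) i) (snd (snd (q a c)) i))"
    by (elim exE) simp
  show ?thesis by (rule that[OF q])
qed

text \<open>
  The differences of the two sides of the multiplicativity axiom at \<open>c \<otimes> b \<otimes> a\<close> and of the
  comultiplicativity axiom at \<open>c \<otimes> a\<close>.  The order of the arguments is that in which they occur in
  \<open>A \<otimes> A \<otimes> C\<close> and \<open>A \<otimes> C\<close>.
\<close>

definition mult_defect :: "'a \<Rightarrow> 'a \<Rightarrow> 'c \<Rightarrow> ('a, 'c, 'k) tensor2" where
  "mult_defect a b c =
     mult_left sA sC (act23 sA sC sA sA sC \<psi> (act12 sC sA sA sC sA \<psi> (pure3 sC sA sA c b a))) -
     \<psi> (mult_right sC sA (pure3 sC sA sA c b a))"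

definition comult_defect :: "'a \<Rightarrow> 'c \<Rightarrow> ('a, 'c, 'c, 'k) tensor3" where
  "comult_defect a c =
     act12 sC sA sA sC sC \<psi> (act23 sC sC sA sA sC \<psi> (comult_left sC sA \<Delta> (pure2 sC sA c a))) -
     comult_right sA sC \<Delta> (\<psi> (pure2 sC sA c a))"

lemmas act12_\<psi>A = act12_rules[OF C.vs A.vs A.vs C.vs A.vs \<psi>_linear_map2]
lemmas act23_\<psi>A = act23_rules[OF A.vs C.vs A.vs A.vs C.vs \<psi>_linear_map2]
lemmas act12_\<psi>C = act12_rules[OF C.vs A.vs A.vs C.vs C.vs \<psi>_linear_map2]
lemmas act23_\<psi>C = act23_rules[OF C.vs C.vs A.vs A.vs C.vs \<psi>_linear_map2]

text \<open>
  The unit and counit axioms hold by the normalisation of \<open>X\<close>, and the other two need only be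
  tested on pure tensors.
\<close>

lemma entwining_iff_defects_zero:
  "entwining sA sC \<Delta> \<epsilon> \<psi> \<longleftrightarrow> (\<forall>a b c. mult_defect a b c = 0) \<and> (\<forall>a c. comult_defect a c = 0)"
proof (intro iffI conjI allI)
  assume "entwining sA sC \<Delta> \<epsilon> \<psi>"
  then show "mult_defect a b c = 0" "comult_defect a c = 0" for a b c
    using pure3_in_tensor3_space pure2_in_tensor2_space
    unfolding entwining_def mult_defect_def comult_defect_def by (metis diff_self)+
next
  assume zero: "(\<forall>a b c. mult_defect a b c = 0) \<and> (\<forall>a c. comult_defect a c = 0)"
  have \<psi>_UNIV: "linear_map_on fscale (tensor2_space sC sA) fscale UNIV \<psi>"
    by (rule linear_map_on_UNIV[OF \<psi>_linear_map2])
  have "\<psi> (mult_right sC sA x) =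
      mult_left sA sC (act23 sA sC sA sA sC \<psi> (act12 sC sA sA sC sA \<psi> x))"
    if x: "x \<in> tensor3_space sC sA sA" for x
  proof (rule lift3_unique[OF C.vs A.vs A.vs vector_space_fscale _ _ _ x])
    show "linear_map_on fscale (tensor3_space sC sA sA) fscale UNIV (\<lambda>x. \<psi> (mult_right sC sA x))"
      by (rule linear_map_on_comp[OF linear_map_onI \<psi>_UNIV])
         (simp_all add: mult_right_rules[OF A.k_algebra_axioms C.vs])
    show "linear_map_on fscale (tensor3_space sC sA sA) fscale UNIV
        (\<lambda>x. mult_left sA sC (act23 sA sC sA sA sC \<psi> (act12 sC sA sA sC sA \<psi> x)))"
      by (rule linear_map_onI[OF linear_comp[OF linear_comp[OF act12_\<psi>A(1) act23_\<psi>A(1)]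
              mult_left_rules(1)[OF A.k_algebra_axioms C.vs]]]) simp
    show "\<psi> (mult_right sC sA (pure3 sC sA sA c a b)) =
      mult_left sA sC (act23 sA sC sA sA sC \<psi> (act12 sC sA sA sC sA \<psi> (pure3 sC sA sA c a b)))"
      for c a b using zero by (simp add: mult_defect_def)
  qed
  moreover have "comult_right sA sC \<Delta> (\<psi> x) =
      act12 sC sA sA sC sC \<psi> (act23 sC sC sA sA sC \<psi> (comult_left sC sA \<Delta> x))"
    if x: "x \<in> tensor2_space sC sA" for x
  proof (rule lift2_unique[OF C.vs A.vs vector_space_fscale _ _ _ x])
    show "linear_map_on fscale (tensor2_space sC sA) fscale UNIV (\<lambda>x. comult_right sA sC \<Delta> (\<psi> x))"
      by (rule linear_map_on_comp[OF \<psi>_UNIV linear_map_onI[OF C.comult_right_rules(1)[OF A.vs]]]) simp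
    show "linear_map_on fscale (tensor2_space sC sA) fscale UNIV
        (\<lambda>x. act12 sC sA sA sC sC \<psi> (act23 sC sC sA sA sC \<psi> (comult_left sC sA \<Delta> x)))"
      by (rule linear_map_onI[OF linear_comp[OF linear_comp[OF C.comult_left_rules(1)[OF A.vs]
              act23_\<psi>C(1)] act12_\<psi>C(1)]]) simp
    show "comult_right sA sC \<Delta> (\<psi> (pure2 sC sA c a)) =
      act12 sC sA sA sC sC \<psi> (act23 sC sC sA sA sC \<psi> (comult_left sC sA \<Delta> (pure2 sC sA c a)))"
      for c a using zero by (simp add: comult_defect_def)
  qed
  moreover have "counit_right sA sC \<epsilon> (\<psi> x) = counit_left sC sA \<epsilon> x"
    if x: "x \<in> tensor2_space sC sA" for x
  proof (rule lift2_unique[OF C.vs A.vs A.vs _ _ _ x])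
    show "linear_map_on fscale (tensor2_space sC sA) sA UNIV (\<lambda>x. counit_right sA sC \<epsilon> (\<psi> x))"
      by (rule linear_map_on_comp[OF \<psi>_UNIV linear_map_onI[OF C.counit_right_rules(1)[OF A.vs]]]) simp
    show "linear_map_on fscale (tensor2_space sC sA) sA UNIV (counit_left sC sA \<epsilon>)"
      by (rule linear_map_onI[OF C.counit_left_rules(1)[OF A.vs]]) simp
    show "counit_right sA sC \<epsilon> (\<psi> (pure2 sC sA c a)) = counit_left sC sA \<epsilon> (pure2 sC sA c a)" for c a
      by (simp add: \<psi>_pure X_counit pure2_in_tensor2_space C.counit_right_rules(2)[OF A.vs]
          C.counit_left_rules(2)[OF A.vs])
  qed
  ultimately show "entwining sA sC \<Delta> \<epsilon> \<psi>"
    unfolding entwining_def by (auto simp: \<psi>_linear_map2 \<psi>_pure X_unit)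
qed

subsection \<open>The mixed commutators\<close>

lemma mult_defect_in_space: "mult_defect a b c \<in> tensor2_space sA sC"
  unfolding mult_defect_def mult_right_rules(2)[OF A.k_algebra_axioms C.vs] \<psi>_pure
  by (intro tensor2_space_rules(3) mult_left_rules(3) act12_\<psi>A(3) act23_\<psi>A(3)
      pure3_in_tensor3_space A.k_algebra_axioms C.vs X_in_space)

text \<open>
  With \<open>w\<close> the first term of the defect, \<open>W\<^sub>1\<^sub>2 X\<^sub>1\<^sub>3 X\<^sub>2\<^sub>3\<close> yields unit terms built from \<open>w\<close>, and
  \<open>X\<^sub>2\<^sub>3 X\<^sub>1\<^sub>3 W\<^sub>1\<^sub>2\<close> yields the same terms built from \<open>X (ba \<otimes> c)\<close>; the flip terms agree.
\<close>

lemma commutator_WXX: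
  "yb_commutator sA sA sC (W_map sA s r) X X (pure3 sA sA sC a b c) =
     fscale s (ins2 sA sA sC 1 (mult_defect a b c)) + fscale r (ins1 sA sA sC 1 (mult_defect a b c))"
proof -
  obtain n :: "'a \<Rightarrow> 'c \<Rightarrow> nat" and l m
    where X: "\<And>a c. X (pure2 sA sC a c) = (\<Sum>i<n a c. pure2 sA sC (l a c i) (m a c i))"
    by (rule X_sum_of_pures) (rule that)
  define R12 where "R12 = act12 sA sA sA sA sC (W_map sA s r)"
  define S13 where "S13 = act13 sA sA sC X"
  define T23 where "T23 = act23 sA sA sC sA sC X"
  note R12 = act12_rules[OF A.vs A.vs A.vs A.vs C.vs A.W_linear_map2[of s r], folded R12_def]
  note S13 = act13_rules[OF A.vs A.vs C.vs X_linear, folded S13_def]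
  note T23 = act23_rules[OF A.vs A.vs C.vs A.vs C.vs X_linear, folded T23_def]
  note ins = ins_linear[OF A.vs A.vs C.vs]
  note lin = linear_rules[OF R12(1)] linear_rules[OF S13(1)] linear_rules[OF T23(1)]
    linear_rules[OF ins(1)] linear_rules[OF ins(2)] linear_rules[OF ins(3)]
  note ins' = ins_linear[OF A.vs C.vs A.vs]
  note lin' = linear_rules[OF act12_\<psi>A(1)] linear_rules[OF act23_\<psi>A(1)]
    linear_rules[OF ins'(3)] linear_rules[OF mult_left_rules(1)[OF A.k_algebra_axioms C.vs]]
  define w where "w = (\<Sum>i<n b c. \<Sum>j<n a (m b c i).
    pure2 sA sC (l b c i * l a (m b c i) j) (m a (m b c i) j))"
  have defect: "mult_defect a b c = w - X (pure2 sA sC (b * a) c)"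
    unfolding mult_defect_def w_def
    by (simp add: mult_right_rules[OF A.k_algebra_axioms C.vs] \<psi>_pure)
       (simp add: act12_\<psi>A(2) act23_\<psi>A(2) \<psi>_pure X lin' ins_pure[OF A.vs C.vs A.vs]
        ins_pure[OF A.vs A.vs C.vs] ins(1)[THEN linear_rule_sum]
        mult_left_rules[OF A.k_algebra_axioms C.vs])
  have swap: "T23 (S13 (pure3 sA sA sC b a c)) =
      (\<Sum>i<n b c. \<Sum>j<n a (m b c i). pure3 sA sA sC (l b c i) (l a (m b c i) j) (m a (m b c i) j))"
    by (simp add: T23(2) S13(2) X lin ins_pure[OF A.vs A.vs C.vs])
  have "R12 (S13 (T23 (pure3 sA sA sC a b c))) =
      fscale s (ins2 sA sA sC 1 w) + fscale r (ins1 sA sA sC 1 w) -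
      fscale s (T23 (S13 (pure3 sA sA sC b a c)))"
    unfolding swap w_def
    by (simp add: T23(2) S13(2) R12(2) A.W_pure X lin ins_pure[OF A.vs A.vs C.vs] fscale_rules
        sum.distrib sum_subtractf)
  \<comment> \<open>A unit in the second factor is not affected by \<open>X\<close> acting on the last two.\<close>
  moreover have T23_ins2: "T23 (ins2 sA sA sC 1 t) = ins2 sA sA sC 1 t"
    if "t \<in> tensor2_space sA sC" for t
    by (rule tensor2_ext[OF linear_comp[OF ins(2) T23(1)] ins(2) _ that])
       (simp add: ins_pure[OF A.vs A.vs C.vs] T23(2) X_unit)
  have "T23 (S13 (R12 (pure3 sA sA sC a b c))) =
      fscale s (ins2 sA sA sC 1 (X (pure2 sA sC (b * a) c))) +
      fscale r (ins1 sA sA sC 1 (X (pure2 sA sC (b * a) c))) -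
      fscale s (T23 (S13 (pure3 sA sA sC b a c)))"
    by (simp only: R12(2) A.W_pure lin ins_pure[OF A.vs A.vs C.vs])
       (simp add: S13(2)[of 1] S13(2)[of _ 1] T23_ins2 X_in_space X_unit T23(2)[of 1]
        ins_pure[OF A.vs A.vs C.vs])
  ultimately show ?thesis
    by (simp add: yb_commutator_def Let_def flip: R12_def S13_def T23_def)
       (simp add: defect lin fscale_rules)
qed

text \<open>The counit normalisation of \<open>X\<close> in terms of a representation by pure tensors.\<close>

lemma X_counit_sum:
  assumes "X (pure2 sA sC a c) = (\<Sum>i<(n::nat). pure2 sA sC (l i) (m i))"
  shows "(\<Sum>i<n. sA (\<epsilon> (m i)) (l i)) = sA (\<epsilon> c) a"
  using X_counit[OF pure2_in_tensor2_space, of a c]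
  by (simp add: assms linear_rules[OF C.counit_right_rules(1)[OF A.vs]]
      C.counit_right_rules(2)[OF A.vs])

text \<open>
  Applying \<open>X\<^sub>1\<^sub>3 X\<^sub>1\<^sub>2\<close> first leaves the counits of \<open>Z\<close> at second factors of values of \<open>X\<close>, where the
  counit normalisation removes one of the two copies of \<open>X\<close>.
\<close>

lemma commutator_XXZ:
  "yb_commutator sA sC sC X X (Z_map sC \<Delta> \<epsilon> t p) (pure3 sA sC sC a c d) =
     fscale (t * \<epsilon> c) (comult_defect a d) + fscale (p * \<epsilon> d) (comult_defect a c)"
proof -
  obtain n :: "'a \<Rightarrow> 'c \<Rightarrow> nat" and l m
    where X: "\<And>a c. X (pure2 sA sC a c) = (\<Sum>i<n a c. pure2 sA sC (l a c i) (m a c i))"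
    by (rule X_sum_of_pures) (rule that)
  define R12 where "R12 = act12 sA sC sA sC sC X"
  define S13 where "S13 = act13 sA sC sC X"
  define T23 where "T23 = act23 sA sC sC sC sC (Z_map sC \<Delta> \<epsilon> t p)"
  define D where "D = comult_right sA sC \<Delta>"
  note R12 = act12_rules[OF A.vs C.vs A.vs C.vs C.vs X_linear, folded R12_def]
  note S13 = act13_rules[OF A.vs C.vs C.vs X_linear, folded S13_def]
  note T23 = act23_rules[OF A.vs C.vs C.vs C.vs C.vs C.Z_linear_map2[of t p], folded T23_def]
  note D = C.comult_right_rules[OF A.vs, folded D_def]
  note ins = ins_linear[OF A.vs C.vs C.vs]
  note lin = linear_rules[OF R12(1)] linear_rules[OF S13(1)] linear_rules[OF T23(1)]
    linear_rules[OF ins(1)] linear_rules[OF ins(2)] linear_rules[OF ins(3)] linear_rules[OF D(1)]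
  note ins' = ins_linear[OF C.vs A.vs C.vs]
  note ins_CCA = ins_linear[OF C.vs C.vs A.vs]
  have entwined: "act12 sC sA sA sC sC \<psi> (act23 sC sC sA sA sC \<psi> (ins3 sC sC sA a' u)) =
      R12 (S13 (ins1 sA sC sC a' u))" if "u \<in> tensor2_space sC sC" for a' u
    by (rule tensor2_ext[OF linear_comp[OF linear_comp[OF ins_CCA(3) act23_\<psi>C(1)] act12_\<psi>C(1)]
          linear_comp[OF linear_comp[OF ins(1) S13(1)] R12(1)] _ that])
       (simp add: ins_pure A.vs C.vs act12_\<psi>C(2) act23_\<psi>C(2) R12(2) S13(2) \<psi>_pure X lin
         linear_rules[OF act12_\<psi>C(1)] linear_rules[OF ins'(1)])
  have defect: "comult_defect a' c' = R12 (S13 (ins1 sA sC sC a' (\<Delta> c'))) - D (X (pure2 sA sC a' c'))"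
    for a' c'
    by (simp add: comult_defect_def C.comult_left_rules[OF A.vs] entwined C.comult_in_space
        \<psi>_pure D_def)
  have swap: "R12 (S13 (pure3 sA sC sC a d c)) = (\<Sum>i<n a c. \<Sum>j<n (l a c i) d.
      pure3 sA sC sC (l (l a c i) d j) (m (l a c i) d j) (m a c i))"
    by (simp add: R12(2) S13(2) X lin ins_pure[OF A.vs C.vs C.vs])
  have "R12 (S13 (T23 (pure3 sA sC sC a c d))) =
      fscale (t * \<epsilon> c) (R12 (S13 (ins1 sA sC sC a (\<Delta> d)))) +
      fscale (p * \<epsilon> d) (R12 (S13 (ins1 sA sC sC a (\<Delta> c)))) -
      fscale p (R12 (S13 (pure3 sA sC sC a d c)))"
    by (simp add: T23(2) C.Z_pure lin ins_pure[OF A.vs C.vs C.vs])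
  moreover have "T23 (S13 (R12 (pure3 sA sC sC a c d))) =
      fscale (t * \<epsilon> c) (D (X (pure2 sA sC a d))) +
      fscale (p * \<epsilon> d) (D (X (pure2 sA sC a c))) -
      fscale p (R12 (S13 (pure3 sA sC sC a d c)))"
  proof -
    have "T23 (S13 (R12 (pure3 sA sC sC a c d))) =
      (\<Sum>i<n a c. \<Sum>j<n (l a c i) d.
         fscale (t * \<epsilon> (m a c i)) (D (pure2 sA sC (l (l a c i) d j) (m (l a c i) d j)))) +
      (\<Sum>i<n a c. \<Sum>j<n (l a c i) d.
         fscale (p * \<epsilon> (m (l a c i) d j)) (D (pure2 sA sC (l (l a c i) d j) (m a c i)))) -
      fscale p (R12 (S13 (pure3 sA sC sC a d c)))"
      unfolding swap
      by (simp add: T23(2) C.Z_pure R12(2) S13(2) X lin ins_pure[OF A.vs C.vs C.vs] D(2)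
          fscale_rules sum.distrib sum_subtractf)
    \<comment> \<open>In the first sum the counit acts on the value of the inner \<open>X\<close>, in the second on that of the
      outer one.\<close>
    also have "(\<Sum>i<n a c. \<Sum>j<n (l a c i) d.
        fscale (t * \<epsilon> (m a c i)) (D (pure2 sA sC (l (l a c i) d j) (m (l a c i) d j)))) =
        (\<Sum>i<n a c. fscale (t * \<epsilon> (m a c i)) (D (X (pure2 sA sC (l a c i) d))))"
      by (simp add: X lin fscale_rules)
    also have "\<dots> = fscale t (D (X (pure2 sA sC (\<Sum>i<n a c. sA (\<epsilon> (m a c i)) (l a c i)) d)))"
      by (simp add: linear_rules[OF bilinear_slice(1)[OF X_bilinear]] lin fscale_rules)
    also have "\<dots> = fscale (t * \<epsilon> c) (D (X (pure2 sA sC a d)))"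
      by (simp add: X_counit_sum[OF X] linear_rules[OF bilinear_slice(1)[OF X_bilinear]] lin
          fscale_rules)
    also have "(\<Sum>i<n a c. \<Sum>j<n (l a c i) d.
        fscale (p * \<epsilon> (m (l a c i) d j)) (D (pure2 sA sC (l (l a c i) d j) (m a c i)))) =
        fscale p (\<Sum>i<n a c. D (pure2 sA sC
          (\<Sum>j<n (l a c i) d. sA (\<epsilon> (m (l a c i) d j)) (l (l a c i) d j)) (m a c i)))"
      by (simp add: linear_rules[OF pure2_linear(1)[OF A.vs C.vs]] lin fscale_rules)
    also have "\<dots> = fscale (p * \<epsilon> d) (D (X (pure2 sA sC a c)))"
      by (simp add: X_counit_sum[OF X] linear_rules[OF pure2_linear(1)[OF A.vs C.vs]] lin
          fscale_rules X)
    finally show ?thesis .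
  qed
  ultimately show ?thesis
    by (simp add: yb_commutator_def Let_def flip: R12_def S13_def T23_def)
       (simp add: defect fscale_rules)
qed

lemma yang_baxter_system_iff_commutators:
  "yang_baxter_system sA sC (W_map sA s r) X (Z_map sC \<Delta> \<epsilon> t p) \<longleftrightarrow>
     (\<forall>a b c. fscale s (ins2 sA sA sC 1 (mult_defect a b c)) +
        fscale r (ins1 sA sA sC 1 (mult_defect a b c)) = 0) \<and>
     (\<forall>a c d. fscale (t * \<epsilon> c) (comult_defect a d) + fscale (p * \<epsilon> d) (comult_defect a c) = 0)"
  unfolding yang_baxter_system_def
    yb_commutator_rules(3)[OF A.vs A.vs C.vs A.W_linear_map2 X_linear X_linear]
    yb_commutator_rules(3)[OF A.vs C.vs C.vs X_linear X_linear C.Z_linear_map2]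
    commutator_WXX commutator_XXZ
  using A.W_yang_baxter C.Z_yang_baxter A.W_linear_map2 C.Z_linear_map2 X_linear by auto

lemma entwining_imp_yang_baxter_system:
  assumes "entwining sA sC \<Delta> \<epsilon> \<psi>"
  shows "yang_baxter_system sA sC (W_map sA s r) X (Z_map sC \<Delta> \<epsilon> t p)"
  using assms unfolding entwining_iff_defects_zero yang_baxter_system_iff_commutators
  by (simp add: linear_rules(4)[OF ins_linear(1)[OF A.vs A.vs C.vs]]
      linear_rules(4)[OF ins_linear(2)[OF A.vs A.vs C.vs]]) (simp add: fscale_def fun_eq_iff)

text \<open>A nonzero vector is recovered from its coproduct by the counit, which is therefore nonzero.\<close>

lemma counit_nonzero:
  fixes c :: 'c
  assumes "c \<noteq> 0"
  obtains e where "\<epsilon> e \<noteq> 0"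
proof -
  have "\<exists>e. \<epsilon> e \<noteq> 0"
  proof (rule ccontr)
    assume "\<nexists>e. \<epsilon> e \<noteq> 0"
    then have "counit_left sC sC \<epsilon> (\<Delta> c) = 0"
      using tensor2_ext[OF C.counit_left_rules(1)[OF C.vs] _ _ C.comult_in_space,
          of "\<lambda>_. 0" c] C.vs vector_space_fscale
      by (simp add: C.counit_left_rules(2)[OF C.vs] Vector_Spaces.linear_iff)
    with assms show False by (simp add: C.counit_left)
  qed
  then show ?thesis using that by blast
qed

lemma fscale_eq_0: "fscale k \<phi> = 0 \<Longrightarrow> k \<noteq> 0 \<Longrightarrow> \<phi> = 0"
  by (auto simp: fscale_def fun_eq_iff)

lemma yang_baxter_system_imp_entwining:
  assumes "s + r \<noteq> 0" "t + p \<noteq> 0"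
    and "yang_baxter_system sA sC (W_map sA s r) X (Z_map sC \<Delta> \<epsilon> t p)"
  shows "entwining sA sC \<Delta> \<epsilon> \<psi>"
  unfolding entwining_iff_defects_zero
proof (intro conjI allI)
  note yb = assms(3)[unfolded yang_baxter_system_iff_commutators]
  note mult = mult_left_rules[OF A.k_algebra_axioms C.vs]
  note ins = ins_linear[OF A.vs A.vs C.vs]
  show "mult_defect a b c = 0" for a b c
  proof -
    have unit: "mult_left sA sC (ins1 sA sA sC 1 u) = u" "mult_left sA sC (ins2 sA sA sC 1 u) = u"
      if "u \<in> tensor2_space sA sC" for u
      by (rule tensor2_ext[OF linear_comp[OF ins(1) mult(1)] _ _ that]
               tensor2_ext[OF linear_comp[OF ins(2) mult(1)] _ _ that];
          simp add: ins_pure A.vs C.vs mult Vector_Spaces.linear_iff vector_space_fscale)+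
    have "mult_left sA sC (fscale s (ins2 sA sA sC 1 (mult_defect a b c)) +
        fscale r (ins1 sA sA sC 1 (mult_defect a b c))) = fscale (s + r) (mult_defect a b c)"
      by (simp add: linear_rules[OF mult(1)] unit mult_defect_in_space)
         (simp add: fscale_def fun_eq_iff algebra_simps)
    moreover have "fscale s (ins2 sA sA sC 1 (mult_defect a b c)) +
        fscale r (ins1 sA sA sC 1 (mult_defect a b c)) = 0"
      using yb by blast
    ultimately have "fscale (s + r) (mult_defect a b c) = 0"
      by (simp add: linear_rules[OF mult(1)])
    then show ?thesis by (rule fscale_eq_0) (rule assms(1))
  qed
  show "comult_defect a c = 0" for a c
  proof (cases "c = 0")
    case True
    have "X (pure2 sA sC a 0) = 0"
      by (rule linear_rule_zero[OF bilinear_slice(2)[OF X_bilinear]])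
    then show ?thesis
      by (simp add: True comult_defect_def \<psi>_pure C.comult_left_rules[OF A.vs] C.comult_rules
          linear_rules[OF ins_linear(3)[OF C.vs C.vs A.vs]] linear_rules[OF act12_\<psi>C(1)]
          linear_rules[OF act23_\<psi>C(1)] linear_rules[OF C.comult_right_rules(1)[OF A.vs]])
  next
    case False
    then obtain e where e: "\<epsilon> e \<noteq> 0" by (rule counit_nonzero)
    have add: "fscale k \<phi> + fscale k' \<phi> = fscale (k + k') \<phi>" for k k' and \<phi> :: "('a, 'c, 'c, 'k) tensor3"
      by (simp add: fscale_def fun_eq_iff algebra_simps)
    have "fscale (t * \<epsilon> e) (comult_defect a e) + fscale (p * \<epsilon> e) (comult_defect a e) = 0"
      using yb by blast
    then have "fscale ((t + p) * \<epsilon> e) (comult_defect a e) = 0"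
      by (simp only: add distrib_right)
    then have zero_e: "comult_defect a e = 0"
      by (rule fscale_eq_0) (use assms(2) e in simp)
    have "fscale (t * \<epsilon> e) (comult_defect a c) + fscale (p * \<epsilon> c) (comult_defect a e) = 0"
      "fscale (t * \<epsilon> c) (comult_defect a e) + fscale (p * \<epsilon> e) (comult_defect a c) = 0"
      using yb by blast+
    then have "fscale (t * \<epsilon> e) (comult_defect a c) = 0" "fscale (p * \<epsilon> e) (comult_defect a c) = 0"
      unfolding zero_e by (auto simp: fscale_def fun_eq_iff)
    then have "fscale ((t + p) * \<epsilon> e) (comult_defect a c) = 0"
      by (simp add: distrib_right flip: add)
    then show ?thesis
      by (rule fscale_eq_0) (use assms(2) e in simp)
  qed
qed

end

theorem theorem2p3:
  fixes sA :: "'k::field \<Rightarrow> 'a::{ring, monoid_mult} \<Rightarrow> 'a"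
    and sC :: "'k \<Rightarrow> 'c::ab_group_add \<Rightarrow> 'c"
    and \<Delta> :: "'c \<Rightarrow> ('c, 'c, 'k) tensor2" and \<epsilon> :: "'c \<Rightarrow> 'k"
    and X :: "('a, 'c, 'k) tensor2 \<Rightarrow> ('a, 'c, 'k) tensor2"
  assumes "k_algebra sA"
    and "k_coalgebra sC \<Delta> \<epsilon>"
    and "linear_map2 sA sC sA sC X"
    and "\<forall>c. X (pure2 sA sC 1 c) = pure2 sA sC 1 c"
    and "\<forall>x \<in> tensor2_space sA sC. counit_right sA sC \<epsilon> (X x) = counit_right sA sC \<epsilon> x"
  shows "((\<forall>s r t p. yang_baxter_system sA sC (W_map sA s r) X (Z_map sC \<Delta> \<epsilon> t p)) \<longleftrightarrow>
            entwining sA sC \<Delta> \<epsilon> (X \<circ> flip sC sA)) \<and>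
         (\<forall>s r t p. s + r \<noteq> 0 \<longrightarrow> t + p \<noteq> 0 \<longrightarrow>
            (yang_baxter_system sA sC (W_map sA s r) X (Z_map sC \<Delta> \<epsilon> t p) \<longleftrightarrow>
             entwining sA sC \<Delta> \<epsilon> (X \<circ> flip sC sA)))"
proof -
  interpret entwining_candidate sA sC \<Delta> \<epsilon> X
    using assms by (simp add: entwining_candidate_def entwining_candidate_axioms_def)
  have "entwining sA sC \<Delta> \<epsilon> \<psi>"
    if "\<forall>s r t p. yang_baxter_system sA sC (W_map sA s r) X (Z_map sC \<Delta> \<epsilon> t p)"
    by (rule yang_baxter_system_imp_entwining[of 1 0 1 0]) (use that in auto)
  then show ?thesis
    using entwining_imp_yang_baxter_system yang_baxter_system_imp_entwining
    unfolding \<psi>_def by blast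
qed

end
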